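(* Let $P=(E,\mathrm{cd})$ be a polymatroid without loops and with $\mathrm{cd}(E)>0$, and let $r=\mathrm{cd}(E)-1$. Then \[ \overline{\chi}_P(\lambda)=\sum_{i=0}^{r}(-1)^{r-i}\deg(\alpha_P^{\,i}\,\beta_P^{\,r-i})\,\lambda^i. \]
   Context: A polymatroid $P=(E,\mathrm{cd})$ is a finite set $E$ with a function $\mathrm{cd}\colon 2^E\to\mathbb N$ such that $\mathrm{cd}(\emptyset)=0$, $\mathrm{cd}(A)\le \mathrm{cd}(B)$ if $A\subseteq B$, and $\mathrm{cd}(A\cup B)+\mathrm{cd}(A\cap B)\le \mathrm{cd}(A)+\mathrm{cd}(B)$. It has no loops if $\mathrm{cd}(\{e\})>0$ for all $e\in E$. The closure of $A\subseteq E$ is $\{a\in E: \mathrm{cd}(A\cup\{a\})=\mathrm{cd}(A)\}$; a flat is a closed set; the flats ordered by inclusion form a lattice $L$ with minimum $\hat 0$ and maximum $\hat 1=E$. For $X\subseteq L$, $X_{<g}=\{x\in X:x<g\}$, $\bigvee X$ is the join ($\bigvee\emptyset=\hat 0$). Let $\mathcal G_{\max}=L\setminus\{\hat 0\}$ (the maximal building set). The Chow ring $\mathrm{DP}(P)$ is the graded $\mathbb Q$-algebra $\mathbb Q[x_g\mid g\in\mathcal G_{\max}]$ ($x_g$ in degree $1$) modulo the relations $\prod_{s\in S}x_s\cdot(\sum_{h\ge g}x_h)^b=0$ for all $S\subseteq\mathcal G_{\max}$, $g\in\mathcal G_{\max}$, $b\ge\mathrm{cd}(g)-\mathrm{cd}(\bigvee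 S_{<g})$. Its top degree is $r=\mathrm{cd}(E)-1$, and $\deg\colon\mathrm{DP}^r(P)\to\mathbb Q$ is the isomorphism with $\deg(x_{\hat 1}^{\,r})=(-1)^r$. Put $\alpha_P=-x_{\hat 1}$ and $\beta_P=\sum_{g\in\mathcal G_{\max}}x_g$ in $\mathrm{DP}^1(P)$. The characteristic polynomial is $\chi_P(\lambda)=\sum_{g\in L}\mu_L(\hat 0,g)\lambda^{\mathrm{cd}(\hat 1)-\mathrm{cd}(g)}$, with $\mu_L$ the Möbius function of $L$; since $\chi_P(1)=0$, the reduced characteristic polynomial is $\overline\chi_P(\lambda)=\chi_P(\lambda)/(\lambda-1)$. *)

theory Defs
  imports
    "HOL-Algebra.Lattice"
    "HOL-Algebra.QuotRing"
    "HOL-Library.Poly_Mapping"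
    "HOL-Library.FuncSet"
    "HOL-Computational_Algebra.Polynomial"
begin

section \<open>Polymatroids and their lattice of flats\<close>

text \<open>Only the values of \<open>cd\<close> on subsets of \<open>E\<close> matter.\<close>

locale polymatroid =
  fixes E :: "'a set" and cd :: "'a set \<Rightarrow> nat"
  assumes finite_ground: "finite E"
    and cd_empty: "cd {} = 0"
    and cd_mono: "A \<subseteq> B \<Longrightarrow> B \<subseteq> E \<Longrightarrow> cd A \<le> cd B"
    and cd_submodular: "A \<subseteq> E \<Longrightarrow> B \<subseteq> E \<Longrightarrow> cd (A \<union> B) + cd (A \<inter> B) \<le> cd A + cd B"

definition loopless :: "'a set \<Rightarrow> ('a set \<Rightarrow> nat) \<Rightarrow> bool" where
  "loopless E cd \<longleftrightarrow> (\<forall>e\<in>E. cd {e} > 0)"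

definition pm_closure :: "'a set \<Rightarrow> ('a set \<Rightarrow> nat) \<Rightarrow> 'a set \<Rightarrow> 'a set" where
  "pm_closure E cd A = {a \<in> E. cd (A \<union> {a}) = cd A}"

definition flats :: "'a set \<Rightarrow> ('a set \<Rightarrow> nat) \<Rightarrow> 'a set set" where
  "flats E cd = {F. F \<subseteq> E \<and> pm_closure E cd F = F}"

definition flat_lattice :: "'a set \<Rightarrow> ('a set \<Rightarrow> nat) \<Rightarrow> 'a set gorder" where
  "flat_lattice E cd = \<lparr>carrier = flats E cd, eq = (=), le = (\<subseteq>)\<rparr>"

definition max_building_set :: "'a set \<Rightarrow> ('a set \<Rightarrow> nat) \<Rightarrow> 'a set set" where
  "max_building_set E cd = flats E cd - {\<bottom>\<^bsub>flat_lattice E cd\<^esub>}"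

section \<open>The characteristic polynomial\<close>

text \<open>The Moebius function of a finite poset; it is set to \<open>0\<close> wherever it is not defined
  (infinite posets, arguments outside the carrier) and for arguments with \<open>x \<sqsubseteq> y\<close> false.\<close>

function moebius :: "('a, 'b) gorder_scheme \<Rightarrow> 'a \<Rightarrow> 'a \<Rightarrow> int" where
  "moebius L x y =
    (if \<not> (partial_order L \<and> finite (carrier L) \<and> x \<in> carrier L \<and> y \<in> carrier L) then 0
     else if x = y then 1
     else if x \<sqsubseteq>\<^bsub>L\<^esub> y then - (\<Sum>z \<in> {z \<in> carrier L. x \<sqsubseteq>\<^bsub>L\<^esub> z \<and> z \<sqsubset>\<^bsub>L\<^esub> y}. moebius L x z)
     else 0)"
  by pat_completeness auto
termination
proof (relation "measure (\<lambda>(L, x, y). card {z \<in> carrier L. z \<sqsubset>\<^bsub>L\<^esub> y})", goal_cases)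
  case 1
  show ?case by simp
next
  case (2 L x y z)
  then interpret partial_order L by blast
  from 2 have z: "z \<in> carrier L" "z \<sqsubset>\<^bsub>L\<^esub> y" and y: "y \<in> carrier L" and fin: "finite (carrier L)"
    by blast+
  have "{w \<in> carrier L. w \<sqsubset>\<^bsub>L\<^esub> z} \<subseteq> {w \<in> carrier L. w \<sqsubset>\<^bsub>L\<^esub> y}"
    using lless_trans[OF _ z(2) _ z(1) y] by blast
  moreover have "z \<notin> {w \<in> carrier L. w \<sqsubset>\<^bsub>L\<^esub> z}"
    by (simp add: lless_def z(1))
  moreover have "z \<in> {w \<in> carrier L. w \<sqsubset>\<^bsub>L\<^esub> y}"
    using z by blast
  ultimately have "{w \<in> carrier L. w \<sqsubset>\<^bsub>L\<^esub> z} \<subset> {w \<in> carrier L. w \<sqsubset>\<^bsub>L\<^esub> y}"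
    by blast
  moreover have "finite {w \<in> carrier L. w \<sqsubset>\<^bsub>L\<^esub> y}"
    using fin by simp
  ultimately have "card {w \<in> carrier L. w \<sqsubset>\<^bsub>L\<^esub> z} < card {w \<in> carrier L. w \<sqsubset>\<^bsub>L\<^esub> y}"
    by (rule psubset_card_mono[rotated])
  then show ?case by (simp only: in_measure prod.case)
qed

declare moebius.simps [simp del]

definition pm_char_poly :: "'a set \<Rightarrow> ('a set \<Rightarrow> nat) \<Rightarrow> rat poly" where
  "pm_char_poly E cd =
    (\<Sum>g\<in>flats E cd. Polynomial.monom
       (of_int (moebius (flat_lattice E cd) \<bottom>\<^bsub>flat_lattice E cd\<^esub> g)) (cd E - cd g))"

text \<open>\<open>[:-1, 1:]\<close> is \<open>\<lambda> - 1\<close>; the division is exact because the characteristic polynomial of a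
  polymatroid with \<open>cd E > 0\<close> vanishes at \<open>1\<close>.\<close>

definition reduced_char_poly :: "'a set \<Rightarrow> ('a set \<Rightarrow> nat) \<Rightarrow> rat poly" where
  "reduced_char_poly E cd = pm_char_poly E cd div [:-1, 1:]"

section \<open>Polynomial rings in several variables\<close>

text \<open>A monomial is a finitely supported exponent vector \<open>'v \<Rightarrow>\<^sub>0 nat\<close>, and a polynomial a finitely
  supported family of rational coefficients indexed by monomials.\<close>

type_synonym 'v rat_mpoly = "('v \<Rightarrow>\<^sub>0 nat) \<Rightarrow>\<^sub>0 rat"

definition poly_ring :: "'v set \<Rightarrow> 'v rat_mpoly ring" where
  "poly_ring V = \<lparr>carrier = {p. \<forall>m \<in> Poly_Mapping.keys p. Poly_Mapping.keys m \<subseteq> V},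
     monoid.mult = (*), one = 1, zero = 0, add = (+)\<rparr>"

definition mp_var :: "'v \<Rightarrow> 'v rat_mpoly" where
  "mp_var v = Poly_Mapping.single (Poly_Mapping.single v 1) 1"

definition mp_const :: "rat \<Rightarrow> 'v rat_mpoly" where
  "mp_const c = Poly_Mapping.single 0 c"

definition monomial_degree :: "('v \<Rightarrow>\<^sub>0 nat) \<Rightarrow> nat" where
  "monomial_degree m = (\<Sum>v \<in> Poly_Mapping.keys m. Poly_Mapping.lookup m v)"

definition homogeneous_polys :: "'v set \<Rightarrow> nat \<Rightarrow> 'v rat_mpoly set" where
  "homogeneous_polys V d =
    {p \<in> carrier (poly_ring V). \<forall>m \<in> Poly_Mapping.keys p. monomial_degree m = d}"

section \<open>The Chow ring for the maximal building set\<close>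

text \<open>The condition \<open>b \<ge> cd g - cd (\<Squnion>S\<^sub><\<^sub>g)\<close> is written additively to avoid subtraction
  on \<open>nat\<close>.\<close>

definition chow_relations :: "'a set \<Rightarrow> ('a set \<Rightarrow> nat) \<Rightarrow> 'a set rat_mpoly set" where
  "chow_relations E cd =
    {(\<Prod>s\<in>S. mp_var s) * (\<Sum>h \<in> {h \<in> max_building_set E cd. g \<subseteq> h}. mp_var h) ^ b | S g b.
       S \<subseteq> max_building_set E cd \<and> g \<in> max_building_set E cd \<and>
       cd g \<le> b + cd (\<Squnion>\<^bsub>flat_lattice E cd\<^esub> {s \<in> S. s \<subset> g})}"

definition chow_ideal :: "'a set \<Rightarrow> ('a set \<Rightarrow> nat) \<Rightarrow> 'a set rat_mpoly set" where
  "chow_ideal E cd = Idl\<^bsub>poly_ring (max_building_set E cd)\<^esub> (chow_relations E cd)"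

definition chow_ring :: "'a set \<Rightarrow> ('a set \<Rightarrow> nat) \<Rightarrow> 'a set rat_mpoly set ring" where
  "chow_ring E cd = poly_ring (max_building_set E cd) Quot chow_ideal E cd"

definition chow_class ::
  "'a set \<Rightarrow> ('a set \<Rightarrow> nat) \<Rightarrow> 'a set rat_mpoly \<Rightarrow> 'a set rat_mpoly set" where
  "chow_class E cd p = chow_ideal E cd +>\<^bsub>poly_ring (max_building_set E cd)\<^esub> p"

definition chow_gen :: "'a set \<Rightarrow> ('a set \<Rightarrow> nat) \<Rightarrow> 'a set \<Rightarrow> 'a set rat_mpoly set" where
  "chow_gen E cd g = chow_class E cd (mp_var g)"

definition chow_scale ::
  "'a set \<Rightarrow> ('a set \<Rightarrow> nat) \<Rightarrow> rat \<Rightarrow> 'a set rat_mpoly set \<Rightarrow> 'a set rat_mpoly set" where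
  "chow_scale E cd c x = chow_class E cd (mp_const c) \<otimes>\<^bsub>chow_ring E cd\<^esub> x"

definition chow_graded_part ::
  "'a set \<Rightarrow> ('a set \<Rightarrow> nat) \<Rightarrow> nat \<Rightarrow> 'a set rat_mpoly set set" where
  "chow_graded_part E cd d = chow_class E cd ` homogeneous_polys (max_building_set E cd) d"

definition pm_top_degree :: "'a set \<Rightarrow> ('a set \<Rightarrow> nat) \<Rightarrow> nat" where
  "pm_top_degree E cd = cd E - 1"

text \<open>The \<open>\<rat>\<close>-linear isomorphisms from the top degree part onto \<open>\<rat>\<close> with the prescribed
  normalisation. Functions are made extensional outside the top degree part, so that the degree map,
  which is unique on that part, is unique as a HOL function.\<close>

definition is_chow_degree ::
  "'a set \<Rightarrow> ('a set \<Rightarrow> nat) \<Rightarrow> ('a set rat_mpoly set \<Rightarrow> rat) \<Rightarrow> bool" where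
  "is_chow_degree E cd f \<longleftrightarrow>
    (let R = chow_ring E cd; r = pm_top_degree E cd; D = chow_graded_part E cd r in
      f \<in> extensional D \<and> bij_betw f D UNIV \<and>
      (\<forall>x\<in>D. \<forall>y\<in>D. f (x \<oplus>\<^bsub>R\<^esub> y) = f x + f y) \<and>
      (\<forall>c. \<forall>x\<in>D. f (chow_scale E cd c x) = c * f x) \<and>
      f (chow_gen E cd \<top>\<^bsub>flat_lattice E cd\<^esub> [^]\<^bsub>R\<^esub> r) = (-1) ^ r)"

definition chow_degree :: "'a set \<Rightarrow> ('a set \<Rightarrow> nat) \<Rightarrow> 'a set rat_mpoly set \<Rightarrow> rat" where
  "chow_degree E cd = (THE f. is_chow_degree E cd f)"

definition chow_alpha :: "'a set \<Rightarrow> ('a set \<Rightarrow> nat) \<Rightarrow> 'a set rat_mpoly set" where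
  "chow_alpha E cd = \<ominus>\<^bsub>chow_ring E cd\<^esub> chow_gen E cd \<top>\<^bsub>flat_lattice E cd\<^esub>"

definition chow_beta :: "'a set \<Rightarrow> ('a set \<Rightarrow> nat) \<Rightarrow> 'a set rat_mpoly set" where
  "chow_beta E cd = (\<Oplus>\<^bsub>chow_ring E cd\<^esub> g \<in> max_building_set E cd. chow_gen E cd g)"

end

theory Submission
  imports Defs
begin

text \<open>
  In the generators \<open>h\<^sub>g = - (\<Sum>u \<supseteq> g. x\<^sub>u)\<close>, so that \<open>x\<^sub>g = - (\<Sum>u \<supseteq> g. \<mu>(g,u) h\<^sub>u)\<close>, the degree map
  takes only the values 0 and 1 on monomials: it is 1 on a monomial \<open>m\<close> of degree \<open>cd E - 1\<close> iff for
  each nonempty flat \<open>F\<close> fewer than \<open>cd F\<close> factors \<open>h\<^sub>u\<close> of \<open>m\<close> have \<open>u \<subseteq> F\<close> (a dragon-Hall-Rado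
  condition). Call \<open>F\<close> tight for \<open>m\<close> if the number of these factors is \<open>cd F - 1\<close>. By submodularity
  the tight flats above \<open>s\<close> are closed under joins, and Moebius inversion shows that multiplication by
  \<open>x\<^sub>s\<close>, \<open>s \<noteq> E\<close>, turns this functional into the indicator of \<open>s\<close> being a maximal tight flat. That
  indicator depends on a factor \<open>h\<^sub>u\<close> with \<open>u\<close> not below \<open>s\<close> only through the join of \<open>u\<close> and
  \<open>s\<close>, so Weisner's theorem makes the functional vanish on the defining relations. Conversely, the
  relations replace a top-degree monomial by monomials with larger flats until only powers of
  \<open>x\<^sub>E\<close> remain, so the top degree part is spanned by \<open>x\<^sub>E\<close> to the power \<open>cd E - 1\<close>.

  Let \<open>a\<^sub>k(T)\<close> be the value, for the interval below \<open>T\<close>, on the \<open>k\<close>-th power of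
  \<open>\<beta> = (\<Sum>u \<subseteq> T. \<mu>(\<emptyset>,u) h\<^sub>u)\<close>, \<open>u\<close> nonempty. The same two facts give
  \<open>a\<^sub>k\<^sub>+\<^sub>1(T) = - a\<^sub>k(T) + (\<Sum>F \<subseteq> T with cd F = k + 1. a\<^sub>k(F))\<close>, whence
  \<open>a\<^sub>k(T) = (-1)\<^sup>k (\<Sum>g \<subseteq> T with cd g \<le> k. \<mu>(\<emptyset>,g))\<close>. For \<open>T = E\<close> these are, up to sign, the
  coefficients of the reduced characteristic polynomial.\<close>

section \<open>Linear functionals and substitutions on polynomial rings\<close>

text \<open>The scalar map \<open>h\<close> lets one construction serve twice: the identity gives
  rational functionals prescribed on monomials, and \<open>mp_const\<close> gives the algebra maps
  \<open>substitution\<close>.\<close>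

definition linear_extension ::
  "(rat \<Rightarrow> 'b) \<Rightarrow> ('k \<Rightarrow> 'b) \<Rightarrow> ('k \<Rightarrow>\<^sub>0 rat) \<Rightarrow> 'b::comm_ring_1" where
  "linear_extension h f p = (\<Sum>m\<in>Poly_Mapping.keys p. h (Poly_Mapping.lookup p m) * f m)"

locale scalar_map =
  fixes h :: "rat \<Rightarrow> 'b::comm_ring_1"
  assumes scalar_add: "h (a + b) = h a + h b"
    and scalar_mult: "h (a * b) = h a * h b"
    and scalar_one: "h 1 = 1"
begin

lemma scalar_zero: "h 0 = 0"
  using scalar_add[of 0 0] by simp

lemma scalar_sum: "(\<Sum>i\<in>A. h (c i)) = h (\<Sum>i\<in>A. c i)"
  by (induction A rule: infinite_finite_induct) (simp_all add: scalar_zero scalar_add)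

lemma linear_extension_superset:
  assumes "finite K" "Poly_Mapping.keys p \<subseteq> K"
  shows "linear_extension h f p = (\<Sum>m\<in>K. h (Poly_Mapping.lookup p m) * f m)"
  unfolding linear_extension_def
  by (rule sum.mono_neutral_left[OF assms]) (auto simp: in_keys_iff scalar_zero)

lemma linear_extension_zero [simp]: "linear_extension h f 0 = 0"
  by (simp add: linear_extension_def)

lemma linear_extension_add:
  "linear_extension h f (p + q) = linear_extension h f p + linear_extension h f q"
proof -
  let ?K = "Poly_Mapping.keys p \<union> Poly_Mapping.keys q"
  have "Poly_Mapping.keys (p + q) \<subseteq> ?K" by (rule Poly_Mapping.keys_add)
  then show ?thesis
    using linear_extension_superset[of ?K "p + q"] linear_extension_superset[of ?K p]
      linear_extension_superset[of ?K q]
    by (simp add: lookup_add scalar_add ring_distribs sum.distrib)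
qed

lemma linear_extension_single [simp]: "linear_extension h f (Poly_Mapping.single m c) = h c * f m"
  by (subst linear_extension_superset[of "{m}"]) auto

lemma linear_extension_sum:
  "linear_extension h f (\<Sum>i\<in>I. p i) = (\<Sum>i\<in>I. linear_extension h f (p i))"
  by (induction I rule: infinite_finite_induct) (simp_all add: linear_extension_add)

lemma linear_extension_uminus: "linear_extension h f (- p) = - linear_extension h f p"
  using linear_extension_add[of f p "- p"] by (simp add: eq_neg_iff_add_eq_0 add.commute)

lemma linear_extension_cong:
  "(\<And>m. m \<in> Poly_Mapping.keys p \<Longrightarrow> f m = g m) \<Longrightarrow> linear_extension h f p = linear_extension h g p"
  by (simp add: linear_extension_def)

end

lemma poly_mapping_sum_single:
  "p = (\<Sum>m\<in>Poly_Mapping.keys p. Poly_Mapping.single m (Poly_Mapping.lookup p m))"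
proof (rule poly_mapping_eqI)
  fix k
  show "Poly_Mapping.lookup p k = Poly_Mapping.lookup (\<Sum>m\<in>Poly_Mapping.keys p. Poly_Mapping.single m (Poly_Mapping.lookup p m)) k"
    by (auto simp: lookup_sum lookup_single when_def in_keys_iff sum.delta)
qed

context scalar_map
begin

text \<open>Multiplying the argument by \<open>p\<close> amounts to shifting the prescribed values
  by the monomials of \<open>p\<close>; functionals are evaluated on products in this form.\<close>

lemma linear_extension_mult:
  fixes p q :: "'k::comm_monoid_add \<Rightarrow>\<^sub>0 rat"
  shows "linear_extension h f (p * q) =
    linear_extension h (\<lambda>m. linear_extension h (\<lambda>m'. f (m + m')) q) p"
proof -
  have "p * q = (\<Sum>m\<in>Poly_Mapping.keys p. \<Sum>m'\<in>Poly_Mapping.keys q.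
      Poly_Mapping.single (m + m') (Poly_Mapping.lookup p m * Poly_Mapping.lookup q m'))"
    by (subst poly_mapping_sum_single[of p], subst poly_mapping_sum_single[of q])
      (simp add: sum_product mult_single)
  then show ?thesis
    by (simp add: linear_extension_sum scalar_mult)
      (simp add: linear_extension_def sum_distrib_left mult.assoc)
qed

end

interpretation rat_scalar: scalar_map "\<lambda>c::rat. c"
  by unfold_locales auto

interpretation const_scalar: scalar_map "mp_const :: rat \<Rightarrow> 'v rat_mpoly"
  by unfold_locales (auto simp: mp_const_def single_add mult_single)

abbreviation linear_functional :: "('k \<Rightarrow> rat) \<Rightarrow> ('k \<Rightarrow>\<^sub>0 rat) \<Rightarrow> rat" where
  "linear_functional \<equiv> linear_extension (\<lambda>c. c)"

lemma linear_functional_const_mult: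
  "linear_functional f (mp_const c * p) = c * linear_functional f p"
  by (simp add: rat_scalar.linear_extension_mult mp_const_def)

lemma linear_functional_add_fun:
  "linear_functional (\<lambda>m. f m + g m) p = linear_functional f p + linear_functional g p"
  by (simp add: linear_extension_def ring_distribs sum.distrib)

lemma linear_functional_scale_fun:
  "linear_functional (\<lambda>m. c * f m) p = c * linear_functional f p"
  by (simp add: linear_extension_def sum_distrib_left mult.left_commute)

lemma linear_functional_sum_fun:
  "linear_functional (\<lambda>m. \<Sum>i\<in>I. f i m) p = (\<Sum>i\<in>I. linear_functional (f i) p)"
  unfolding linear_extension_def sum_distrib_left by (rule sum.swap)

section \<open>Substitution homomorphisms\<close>

definition monomial_value :: "('v \<Rightarrow> 'b) \<Rightarrow> ('v \<Rightarrow>\<^sub>0 nat) \<Rightarrow> 'b::comm_ring_1" where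
  "monomial_value X m = (\<Prod>v\<in>Poly_Mapping.keys m. X v ^ Poly_Mapping.lookup m v)"

lemma monomial_value_superset:
  assumes "finite K" "Poly_Mapping.keys m \<subseteq> K"
  shows "monomial_value X m = (\<Prod>v\<in>K. X v ^ Poly_Mapping.lookup m v)"
  unfolding monomial_value_def
  by (rule prod.mono_neutral_left[OF assms]) (auto simp: in_keys_iff)

lemma monomial_value_add: "monomial_value X (m + m') = monomial_value X m * monomial_value X m'"
proof -
  let ?K = "Poly_Mapping.keys m \<union> Poly_Mapping.keys m'"
  have "Poly_Mapping.keys (m + m') \<subseteq> ?K" by (rule Poly_Mapping.keys_add)
  then show ?thesis
    using monomial_value_superset[of ?K "m + m'" X] monomial_value_superset[of ?K m X]
      monomial_value_superset[of ?K m' X]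
    by (simp add: lookup_add power_add prod.distrib)
qed

definition substitution :: "('v \<Rightarrow> 'w rat_mpoly) \<Rightarrow> 'v rat_mpoly \<Rightarrow> 'w rat_mpoly" where
  "substitution X = linear_extension mp_const (monomial_value X)"

lemma substitution_mult: "substitution X (p * q) = substitution X p * substitution X q"
  unfolding substitution_def const_scalar.linear_extension_mult monomial_value_add
  by (simp only: linear_extension_def sum_product) (simp add: sum_distrib_left mult_ac)

lemma substitution_add: "substitution X (p + q) = substitution X p + substitution X q"
  and substitution_uminus: "substitution X (- p) = - substitution X p"
  and substitution_sum: "substitution X (\<Sum>i\<in>I. u i) = (\<Sum>i\<in>I. substitution X (u i))"
  by (simp_all add: substitution_def const_scalar.linear_extension_add
      const_scalar.linear_extension_uminus const_scalar.linear_extension_sum)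

lemma substitution_const: "substitution X (mp_const c) = mp_const c"
  by (simp add: substitution_def mp_const_def monomial_value_def)

lemma substitution_var: "substitution X (mp_var v) = X v"
  by (simp add: substitution_def mp_var_def monomial_value_def const_scalar.scalar_one)

lemma substitution_one: "substitution X 1 = 1"
  using substitution_const[of X 1] by (simp add: const_scalar.scalar_one)

lemma substitution_power: "substitution X (p ^ n) = substitution X p ^ n"
  by (induction n) (simp_all add: substitution_one substitution_mult)

lemma substitution_prod: "substitution X (\<Prod>i\<in>I. u i) = (\<Prod>i\<in>I. substitution X (u i))"
  by (induction I rule: infinite_finite_induct) (simp_all add: substitution_one substitution_mult)

lemma mp_var_power: "mp_var v ^ n = Poly_Mapping.single (Poly_Mapping.single v n) 1"
  by (induction n) (simp_all add: mp_var_def mult_single single_add[symmetric])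

section \<open>Flats of a loopless polymatroid\<close>

locale loopless_polymatroid = polymatroid E cd for E :: "'a set" and cd +
  assumes no_loops: "loopless E cd"
begin

abbreviation cl where "cl \<equiv> pm_closure E cd"
abbreviation FL where "FL \<equiv> flats E cd"
abbreviation V where "V \<equiv> max_building_set E cd"

lemma closure_subset_ground: "cl A \<subseteq> E"
  by (auto simp: pm_closure_def)

lemma subset_closure: "A \<subseteq> E \<Longrightarrow> A \<subseteq> cl A"
  by (auto simp: pm_closure_def insert_absorb)

text \<open>Elements of the closure are added one at a time: submodularity for
  \<open>A \<union> B\<close> and \<open>A \<union> {b}\<close>, whose intersection contains
  \<open>A\<close>, shows that \<open>b\<close> does not raise \<open>cd\<close>.\<close>

lemma cd_closure:
  assumes A: "A \<subseteq> E"
  shows "cd (cl A) = cd A"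
proof -
  have "cd (A \<union> B) = cd A" if "finite B" "B \<subseteq> cl A" for B
    using that
  proof (induction B)
    case (insert b B)
    then have b: "b \<in> E" "cd (A \<union> {b}) = cd A" and B: "B \<subseteq> E"
      by (auto simp: pm_closure_def)
    have "cd ((A \<union> B) \<union> (A \<union> {b})) + cd ((A \<union> B) \<inter> (A \<union> {b})) \<le> cd (A \<union> B) + cd (A \<union> {b})"
      using A B b by (intro cd_submodular) auto
    moreover have "cd A \<le> cd ((A \<union> B) \<inter> (A \<union> {b}))"
      using A B by (intro cd_mono) auto
    moreover have "cd A \<le> cd (A \<union> insert b B)"
      using A B b by (intro cd_mono) auto
    moreover have "(A \<union> B) \<union> (A \<union> {b}) = A \<union> insert b B" by auto
    ultimately show ?case using insert b by auto
  qed simp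
  from this[of "cl A"] show ?thesis
    using subset_closure[OF A] closure_subset_ground[of A] finite_ground finite_subset
    by (metis Un_absorb1 subset_refl)
qed

lemma flat_subset: "F \<in> FL \<Longrightarrow> F \<subseteq> E"
  by (simp add: flats_def)

lemma closure_flat: "A \<subseteq> E \<Longrightarrow> cl A \<in> FL"
proof -
  assume A: "A \<subseteq> E"
  have "x \<in> cl A" if x: "x \<in> cl (cl A)" for x
  proof -
    from x have xE: "x \<in> E" and "cd (cl A \<union> {x}) = cd A"
      by (auto simp: pm_closure_def[of E cd "cl A"] cd_closure[OF A])
    moreover have "cd (A \<union> {x}) \<le> cd (cl A \<union> {x})"
      using subset_closure[OF A] closure_subset_ground[of A] xE by (intro cd_mono) auto
    moreover have "cd A \<le> cd (A \<union> {x})"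
      using A xE by (intro cd_mono) auto
    ultimately show ?thesis by (simp add: pm_closure_def)
  qed
  then show ?thesis
    using subset_closure[OF closure_subset_ground[of A]] closure_subset_ground[of A]
    by (auto simp: flats_def)
qed

text \<open>By submodularity, adding \<open>x\<close> to \<open>F\<close> raises \<open>cd\<close>
  by at most as much as adding it to the subset \<open>A\<close>, that is, not at all.\<close>

lemma closure_least:
  assumes F: "F \<in> FL" and AF: "A \<subseteq> F"
  shows "cl A \<subseteq> F"
proof
  fix x assume "x \<in> cl A"
  then have x: "x \<in> E" "cd (A \<union> {x}) = cd A" by (auto simp: pm_closure_def)
  have FE: "F \<subseteq> E" by (rule flat_subset[OF F])
  have "cd (F \<union> (A \<union> {x})) + cd (F \<inter> (A \<union> {x})) \<le> cd F + cd (A \<union> {x})"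
    using FE AF x by (intro cd_submodular) auto
  moreover have "cd A \<le> cd (F \<inter> (A \<union> {x}))"
    using FE AF by (intro cd_mono) auto
  moreover have "F \<union> (A \<union> {x}) = F \<union> {x}" using AF by auto
  moreover have "cd F \<le> cd (F \<union> {x})" using FE x by (intro cd_mono) auto
  ultimately have "cd (F \<union> {x}) = cd F" using x by simp
  then have "x \<in> cl F" using x by (simp add: pm_closure_def)
  then show "x \<in> F" using F by (simp add: flats_def)
qed

lemma flat_Int: "F \<in> FL \<Longrightarrow> G \<in> FL \<Longrightarrow> F \<inter> G \<in> FL"
  using closure_least[of F "F \<inter> G"] closure_least[of G "F \<inter> G"] subset_closure[of "F \<inter> G"]
    flat_subset[of F]
  by (auto simp: flats_def)

lemma flat_cd_strict:
  assumes "F \<in> FL" "G \<in> FL" "F \<subset> G"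
  shows "cd F < cd G"
proof -
  obtain x where x: "x \<in> G" "x \<notin> F" using assms by auto
  have "x \<in> E" using x flat_subset assms by blast
  then have "cd (F \<union> {x}) \<noteq> cd F"
    using assms(1) x by (auto simp: flats_def pm_closure_def)
  moreover have "cd F \<le> cd (F \<union> {x})" "cd (F \<union> {x}) \<le> cd G"
    using flat_subset assms x by (auto intro!: cd_mono)
  ultimately show ?thesis by simp
qed

lemma flat_cd_mono: "G \<in> FL \<Longrightarrow> F \<subseteq> G \<Longrightarrow> cd F \<le> cd G"
  using cd_mono flat_subset by blast

lemma empty_flat: "{} \<in> FL"
  using no_loops by (auto simp: flats_def pm_closure_def loopless_def cd_empty)

lemma ground_flat: "E \<in> FL"
  using subset_closure[of E] closure_subset_ground[of E] by (simp add: flats_def)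

lemma finite_flats [simp]: "finite FL"
  by (rule finite_subset[of _ "Pow E"]) (auto simp: flats_def finite_ground)

lemma join_iff:
  assumes "F \<subseteq> E" "G \<subseteq> E" "H \<in> FL"
  shows "cl (F \<union> G) \<subseteq> H \<longleftrightarrow> F \<subseteq> H \<and> G \<subseteq> H"
  using closure_least[OF assms(3), of "F \<union> G"] subset_closure[of "F \<union> G"] assms by blast

lemma join_flat: "F \<in> FL \<Longrightarrow> G \<in> FL \<Longrightarrow> cl (F \<union> G) \<in> FL"
  by (intro closure_flat) (auto dest: flat_subset)

lemma join_upper: "F \<in> FL \<Longrightarrow> G \<in> FL \<Longrightarrow> F \<subseteq> cl (F \<union> G) \<and> G \<subseteq> cl (F \<union> G)"
  using subset_closure[of "F \<union> G"] flat_subset by blast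

lemma cd_join:
  assumes "F \<in> FL" "G \<in> FL"
  shows "cd (cl (F \<union> G)) + cd (F \<inter> G) \<le> cd F + cd G"
  using cd_submodular[of F G] cd_closure[of "F \<union> G"] flat_subset[OF assms(1)] flat_subset[OF assms(2)]
  by simp

section \<open>Order-theoretic operations on the lattice of flats\<close>

lemma partial_order_flats: "partial_order (flat_lattice E cd)"
  by unfold_locales (auto simp: flat_lattice_def)

lemma bottom_flats: "\<bottom>\<^bsub>flat_lattice E cd\<^esub> = {}"
  unfolding bottom_def
  by (rule some_equality) (auto simp: least_def flat_lattice_def Lower_def empty_flat)

lemma top_flats: "\<top>\<^bsub>flat_lattice E cd\<^esub> = E"
  unfolding top_def
  by (rule some_equality)
    (auto simp: greatest_def flat_lattice_def Lower_def Upper_def ground_flat dest: flat_subset)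

lemma sup_flats_eq:
  assumes "A \<subseteq> FL" "s \<in> FL" "\<And>a. a \<in> A \<Longrightarrow> a \<subseteq> s"
    and "\<And>F. F \<in> FL \<Longrightarrow> (\<And>a. a \<in> A \<Longrightarrow> a \<subseteq> F) \<Longrightarrow> s \<subseteq> F"
  shows "\<Squnion>\<^bsub>flat_lattice E cd\<^esub> A = s"
proof -
  have "least (flat_lattice E cd) s (Upper (flat_lattice E cd) A)"
  proof -
    have "Upper (flat_lattice E cd) A = {F \<in> FL. \<forall>a\<in>A. a \<subseteq> F}"
      using assms(1) by (auto simp: flat_lattice_def Upper_def)
    then show ?thesis using assms(2-4) by (simp add: least_def flat_lattice_def)
  qed
  moreover have "x = s" if "least (flat_lattice E cd) x (Upper (flat_lattice E cd) A)" for x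
    using weak_partial_order.weak_least_unique[OF partial_order.axioms(1)[OF partial_order_flats] that calculation] that calculation
    by (simp add: flat_lattice_def)
  ultimately show ?thesis unfolding sup_def by (rule some_equality)
qed

lemma sup_flats_greatest:
  "s \<in> A \<Longrightarrow> A \<subseteq> FL \<Longrightarrow> (\<And>a. a \<in> A \<Longrightarrow> a \<subseteq> s) \<Longrightarrow> \<Squnion>\<^bsub>flat_lattice E cd\<^esub> A = s"
  by (rule sup_flats_eq) auto

lemma sup_flats_empty: "\<Squnion>\<^bsub>flat_lattice E cd\<^esub> {} = {}"
  by (rule sup_flats_eq) (auto simp: empty_flat)

lemma V_iff: "v \<in> V \<longleftrightarrow> v \<in> FL \<and> v \<noteq> {}"
  by (simp add: max_building_set_def bottom_flats)

lemma finite_V [simp]: "finite V"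
  by (simp add: max_building_set_def)

lemma cd_V_pos: "v \<in> V \<Longrightarrow> 0 < cd v"
  using flat_cd_strict[OF empty_flat, of v] by (metis V_iff empty_subsetI gr_zeroI not_less_zero psubsetI)

section \<open>The Moebius function of the lattice of flats\<close>

definition mu :: "'a set \<Rightarrow> 'a set \<Rightarrow> rat" where
  "mu x y = of_int (moebius (flat_lattice E cd) x y)"

lemma mu_refl: "x \<in> FL \<Longrightarrow> mu x x = 1"
  unfolding mu_def using partial_order_flats
  by (subst moebius.simps) (simp add: flat_lattice_def)

lemma mu_sum_right:
  assumes "x \<in> FL" "y \<in> FL" "x \<subseteq> y"
  shows "(\<Sum>z\<in>{z \<in> FL. x \<subseteq> z \<and> z \<subseteq> y}. mu x z) = of_bool (x = y)"
proof (cases "x = y")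
  case True
  then have "{z \<in> FL. x \<subseteq> z \<and> z \<subseteq> y} = {x}" using assms by auto
  then show ?thesis using True assms by (simp add: mu_refl)
next
  case False
  let ?A = "{z \<in> FL. x \<subseteq> z \<and> z \<subset> y}"
  have "{z \<in> FL. x \<subseteq> z \<and> z \<subseteq> y} = insert y ?A" using assms by auto
  moreover have "moebius (flat_lattice E cd) x y = - (\<Sum>z\<in>?A. moebius (flat_lattice E cd) x z)"
    using partial_order_flats assms False
    by (subst moebius.simps)
      (auto simp: flat_lattice_def lless_def psubset_eq intro!: sum.cong)
  ultimately show ?thesis using False by (simp add: mu_def)
qed

text \<open>In the incidence algebra, \<open>\<zeta> * (\<mu> * \<zeta>) = \<zeta>\<close> gives \<open>(\<zeta> * \<mu>) * \<zeta> = \<zeta>\<close>; the induction cancels the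
  right factor.\<close>

lemma mu_sum_left:
  assumes x: "x \<in> FL" and y: "y \<in> FL" and "x \<subseteq> y"
  shows "(\<Sum>z\<in>{z \<in> FL. x \<subseteq> z \<and> z \<subseteq> y}. mu z y) = of_bool (x = y)"
  using y \<open>x \<subseteq> y\<close>
proof (induction "cd y" arbitrary: y rule: less_induct)
  case less
  let ?I = "\<lambda>a b. {z \<in> FL. a \<subseteq> z \<and> z \<subseteq> b}"
  let ?f = "\<lambda>y. \<Sum>z\<in>?I x y. mu z y"
  have "(\<Sum>w\<in>?I x y. ?f w) = (\<Sum>w\<in>?I x y. \<Sum>z\<in>?I x y. of_bool (z \<subseteq> w) * mu z w)"
    by (intro sum.cong refl sum.mono_neutral_cong_left) auto
  also have "\<dots> = (\<Sum>z\<in>?I x y. \<Sum>w\<in>?I x y. of_bool (z \<subseteq> w) * mu z w)"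
    by (rule sum.swap)
  also have "\<dots> = (\<Sum>z\<in>?I x y. \<Sum>w\<in>?I z y. mu z w)"
    by (intro sum.cong refl sum.mono_neutral_cong_right) auto
  also have "\<dots> = (\<Sum>z\<in>?I x y. of_bool (z = y))"
    using less.prems by (intro sum.cong mu_sum_right) auto
  also have "\<dots> = 1"
    using less.prems by (simp add: sum.delta of_bool_def)
  finally have total: "(\<Sum>w\<in>?I x y. ?f w) = 1" .
  show ?case
  proof (cases "x = y")
    case True
    then have "?I x y = {y}" using less.prems by auto
    then show ?thesis using True less.prems by (simp add: mu_refl)
  next
    case False
    let ?A = "{z \<in> FL. x \<subseteq> z \<and> z \<subset> y}"
    have "?I x y = insert y ?A" using less.prems by auto
    then have "1 = ?f y + (\<Sum>w\<in>?A. ?f w)" using total by simp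
    also have "(\<Sum>w\<in>?A. ?f w) = (\<Sum>w\<in>?A. of_bool (x = w))"
    proof (rule sum.cong[OF refl])
      fix w assume w: "w \<in> ?A"
      show "?f w = of_bool (x = w)"
        by (rule less.hyps) (use w less.prems in \<open>auto intro: flat_cd_strict\<close>)
    qed
    also have "\<dots> = 1" using x less.prems False by (simp add: sum.delta of_bool_def psubset_eq)
    finally show ?thesis using False by simp
  qed
qed

text \<open>The flats \<open>u\<close> above \<open>t\<close> whose join with \<open>s\<close> lies
  below \<open>w\<close> form the empty set or the interval from \<open>t\<close> to
  \<open>w\<close>. In the second case \<open>s \<subseteq> w\<close> excludes \<open>t = w\<close>,
  so the Moebius sum is 0 either way. By induction the fibres over smaller \<open>w'\<close>
  contribute nothing, and only the fibre over \<open>w\<close> is left.\<close>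

lemma weisner:
  assumes t: "t \<in> FL" and s: "s \<in> FL" "\<not> s \<subseteq> t" and w: "w \<in> FL"
  shows "(\<Sum>u\<in>{u \<in> FL. t \<subseteq> u \<and> cl (u \<union> s) = w}. mu t u) = 0"
  using w
proof (induction "cd w" arbitrary: w rule: less_induct)
  case less
  let ?A = "\<lambda>w. {u \<in> FL. t \<subseteq> u \<and> cl (u \<union> s) = w}"
  let ?W = "{w' \<in> FL. w' \<subseteq> w}"
  let ?B = "{u \<in> FL. t \<subseteq> u \<and> cl (u \<union> s) \<subseteq> w}"
  have "cl (u \<union> s) \<subseteq> w \<longleftrightarrow> u \<subseteq> w \<and> s \<subseteq> w" if "u \<in> FL" for u
    using join_iff[OF flat_subset flat_subset] that s less.prems by blast
  then have B: "?B = (if s \<subseteq> w \<and> t \<subseteq> w then {u \<in> FL. t \<subseteq> u \<and> u \<subseteq> w} else {})"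
    by auto
  have "0 = (\<Sum>u\<in>?B. mu t u)"
    unfolding B using mu_sum_right[OF t less.prems] s by auto
  also have "\<dots> = (\<Sum>w'\<in>?W. \<Sum>u\<in>{u \<in> ?B. cl (u \<union> s) = w'}. mu t u)"
    by (rule sum.group[symmetric]) (auto intro: join_flat s)
  also have "\<dots> = (\<Sum>w'\<in>?W. \<Sum>u\<in>?A w'. mu t u)"
    by (intro sum.cong) auto
  also have "?W = insert w {w' \<in> FL. w' \<subset> w}" using less.prems by auto
  also have "(\<Sum>w'\<in>\<dots>. \<Sum>u\<in>?A w'. mu t u) = (\<Sum>u\<in>?A w. mu t u)"
    using less.hyps[OF flat_cd_strict[OF _ less.prems]] by simp
  finally show ?case by simp
qed

text \<open>The function is constant on the fibres of joining with \<open>s\<close>, each of which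
  Weisner's theorem kills. The fibres are complete because \<open>s \<subseteq> T\<close> makes
  \<open>u \<subseteq> T\<close> a condition on the join alone.\<close>

lemma mu_sum_join:
  assumes t: "t \<in> FL" and s: "s \<in> FL" "\<not> s \<subseteq> t" "s \<subseteq> T" and T: "T \<in> FL"
  shows "(\<Sum>u\<in>{u \<in> FL. t \<subseteq> u \<and> u \<subseteq> T}. mu t u * f (cl (u \<union> s))) = 0"
proof -
  let ?B = "{u \<in> FL. t \<subseteq> u \<and> u \<subseteq> T}"
  have up: "u \<subseteq> T \<longleftrightarrow> cl (u \<union> s) \<subseteq> T" if "u \<in> FL" for u
    using join_iff[OF _ _ T, of u s] flat_subset that s by blast
  have "(\<Sum>u\<in>?B. mu t u * f (cl (u \<union> s))) =
      (\<Sum>w\<in>{w \<in> FL. w \<subseteq> T}. \<Sum>u\<in>{u \<in> ?B. cl (u \<union> s) = w}. mu t u * f (cl (u \<union> s)))"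
    using up by (intro sum.group[symmetric]) (auto intro: join_flat s)
  also have "\<dots> = (\<Sum>w\<in>{w \<in> FL. w \<subseteq> T}. (\<Sum>u\<in>{u \<in> FL. t \<subseteq> u \<and> cl (u \<union> s) = w}. mu t u) * f w)"
    unfolding sum_distrib_right using up by (intro sum.cong) auto
  also have "\<dots> = 0"
    using weisner[OF t s(1,2)] by simp
  finally show ?thesis .
qed

section \<open>Counting conditions on monomials\<close>

definition cnt :: "('a set \<Rightarrow>\<^sub>0 nat) \<Rightarrow> 'a set \<Rightarrow> nat" where
  "cnt m F = (\<Sum>v\<in>{v \<in> V. v \<subseteq> F}. Poly_Mapping.lookup m v)"

text \<open>Flats and factors not below \<open>T\<close> are ignored: \<open>T = E\<close> gives the
  degree functional, while smaller \<open>T\<close> serve the recursion for powers of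
  \<beta>.\<close>

definition good :: "'a set \<Rightarrow> ('a set \<Rightarrow>\<^sub>0 nat) \<Rightarrow> bool" where
  "good T m \<longleftrightarrow> (\<forall>F\<in>V. F \<subseteq> T \<longrightarrow> cnt m F < cd F)"

definition max_tight :: "'a set \<Rightarrow> 'a set \<Rightarrow> ('a set \<Rightarrow>\<^sub>0 nat) \<Rightarrow> bool" where
  "max_tight T s m \<longleftrightarrow> good T m \<and> cnt m s + 1 = cd s \<and>
    (\<forall>F\<in>V. s \<subset> F \<and> F \<subseteq> T \<longrightarrow> cnt m F + 1 < cd F)"

lemma cnt_add: "cnt (m + m') F = cnt m F + cnt m' F"
  by (simp add: cnt_def lookup_add sum.distrib)

lemma cnt_single: "v \<in> V \<Longrightarrow> cnt (Poly_Mapping.single v k) F = (if v \<subseteq> F then k else 0)"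
  by (auto simp: cnt_def lookup_single when_def sum.delta)

lemma cnt_zero [simp]: "cnt 0 F = 0"
  by (simp add: cnt_def)

lemma cnt_empty [simp]: "cnt m {} = 0"
  unfolding cnt_def by (rule sum.neutral) (auto simp: V_iff)

text \<open>A factor below both flats is below their intersection and their join; a factor below one
  of them is still below the join.\<close>

lemma cnt_supermodular:
  assumes "F \<in> FL" "G \<in> FL"
  shows "cnt m F + cnt m G \<le> cnt m (cl (F \<union> G)) + cnt m (F \<inter> G)"
proof -
  have eq: "cnt m H = (\<Sum>v\<in>V. if v \<subseteq> H then Poly_Mapping.lookup m v else 0)" for H
    unfolding cnt_def by (rule sum.mono_neutral_cong_left) auto
  show ?thesis
    unfolding eq sum.distrib[symmetric] using join_upper[OF assms]
    by (intro sum_mono) auto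
qed

text \<open>Above a tight flat without larger tight flats, the remaining counting conditions follow by
  submodularity, so that only the part of the monomial below \<open>s\<close> and its image under joining with
  \<open>s\<close> matter.\<close>

lemma max_tight_iff:
  assumes s: "s \<in> V" "s \<subseteq> T" and T: "T \<in> FL"
  shows "max_tight T s m \<longleftrightarrow> good s m \<and> cnt m s + 1 = cd s \<and>
    (\<forall>F\<in>V. s \<subset> F \<and> F \<subseteq> T \<longrightarrow> cnt m F + 1 < cd F)" (is "_ \<longleftrightarrow> ?R")
proof
  assume "max_tight T s m"
  then show ?R using s by (auto simp: max_tight_def good_def)
next
  assume R: ?R
  have "cnt m F < cd F" if F: "F \<in> V" "F \<subseteq> T" for F
  proof (cases "F \<subseteq> s")
    case True
    then show ?thesis using R F by (auto simp: good_def)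
  next
    case False
    have fl: "F \<in> FL" "s \<in> FL" using F s by (auto simp: V_iff)
    let ?J = "cl (F \<union> s)"
    have J: "?J \<in> V" "s \<subset> ?J" "?J \<subseteq> T"
      using join_flat[OF fl] join_upper[OF fl] False F s join_iff[OF _ _ T, of F s] fl flat_subset
      by (auto simp: V_iff)
    then have "cnt m ?J + 1 < cd ?J" using R by blast
    moreover have "cnt m s + 1 = cd s" using R by blast
    \<comment> \<open>The defect \<open>cd F - cnt m F\<close> is submodular. It is at least 2 at
      the join, 1 at \<open>s\<close> and at least 0 at the intersection, hence at least 2 + 0 - 1
      at \<open>F\<close>. The weak bound at the intersection includes the empty set, where both
      numbers are 0.\<close>
    moreover have "cnt m (F \<inter> s) \<le> cd (F \<inter> s)"
      using R flat_Int[OF fl] by (cases "F \<inter> s = {}") (auto simp: good_def V_iff less_imp_le)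
    ultimately show ?thesis
      using cnt_supermodular[OF fl, of m] cd_join[OF fl] by linarith
  qed
  then show "max_tight T s m" using R by (simp add: max_tight_def good_def)
qed

text \<open>By \<open>max_tight_iff\<close> only flats containing \<open>s\<close> or contained in
  \<open>s\<close> matter. The former contain \<open>u\<close> iff they contain the join, and the
  latter contain neither.\<close>

lemma max_tight_join:
  assumes s: "s \<in> V" "s \<subseteq> T" and u: "u \<in> V" "\<not> u \<subseteq> s" and T: "T \<in> FL"
  shows "max_tight T s (Poly_Mapping.single u 1 + m) =
    max_tight T s (Poly_Mapping.single (cl (u \<union> s)) 1 + m)"
proof -
  have fl: "u \<in> FL" "s \<in> FL" using u s by (auto simp: V_iff)
  let ?J = "cl (u \<union> s)"
  have J: "?J \<in> V" using join_flat[OF fl] join_upper[OF fl] u by (auto simp: V_iff)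
  have "u \<subseteq> F \<longleftrightarrow> ?J \<subseteq> F" if "F \<in> FL" "s \<subseteq> F" for F
    using join_iff[of u s F] fl flat_subset that by auto
  then have up: "cnt (Poly_Mapping.single u 1 + m) F = cnt (Poly_Mapping.single ?J 1 + m) F"
    if "F \<in> FL" "s \<subseteq> F" for F
    using that u J by (simp add: cnt_add cnt_single)
  have "\<not> u \<subseteq> F" "\<not> ?J \<subseteq> F" if "F \<subseteq> s" for F
    using u join_upper[OF fl] that by auto
  then have down: "cnt (Poly_Mapping.single u 1 + m) F = cnt (Poly_Mapping.single ?J 1 + m) F"
    if "F \<subseteq> s" for F
    using that u J by (simp add: cnt_add cnt_single)
  have "good s (Poly_Mapping.single u 1 + m) \<longleftrightarrow> good s (Poly_Mapping.single ?J 1 + m)"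
    unfolding good_def by (intro ball_cong refl imp_cong) (simp only: down)
  moreover have "(\<forall>F\<in>V. s \<subset> F \<and> F \<subseteq> T \<longrightarrow> cnt (Poly_Mapping.single u 1 + m) F + 1 < cd F) \<longleftrightarrow>
      (\<forall>F\<in>V. s \<subset> F \<and> F \<subseteq> T \<longrightarrow> cnt (Poly_Mapping.single ?J 1 + m) F + 1 < cd F)"
    by (intro ball_cong refl imp_cong) (metis up V_iff psubset_imp_subset)
  ultimately show ?thesis
    unfolding max_tight_iff[OF s T] using down[of s] by simp
qed

text \<open>Setting the summand to 0 for \<open>u \<subseteq> s\<close>, that is, when the join with
  \<open>s\<close> is \<open>s\<close> itself, makes it a function of the join alone, so
  \<open>mu_sum_join\<close> applies. The flat \<open>t\<close> will be a second generator or, for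
  \<beta>, the empty flat.\<close>

lemma max_tight_sum_zero:
  assumes s: "s \<in> V" "s \<subseteq> T" and T: "T \<in> FL" and t: "t \<in> FL" "\<not> s \<subseteq> t"
  shows "(\<Sum>u\<in>{u \<in> FL. t \<subseteq> u \<and> u \<subseteq> T \<and> \<not> u \<subseteq> s}.
    mu t u * of_bool (max_tight T s (Poly_Mapping.single u 1 + m))) = 0"
proof -
  let ?f = "\<lambda>w. if w \<subseteq> s then 0 else of_bool (max_tight T s (Poly_Mapping.single w 1 + m)) :: rat"
  have sF: "s \<in> FL" using s by (simp add: V_iff)
  have "(\<Sum>u\<in>{u \<in> FL. t \<subseteq> u \<and> u \<subseteq> T \<and> \<not> u \<subseteq> s}.
      mu t u * of_bool (max_tight T s (Poly_Mapping.single u 1 + m))) =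
    (\<Sum>u\<in>{u \<in> FL. t \<subseteq> u \<and> u \<subseteq> T}. mu t u * ?f (cl (u \<union> s)))"
  proof (rule sum.mono_neutral_cong_left; (intro ballI)?)
    fix u assume u: "u \<in> {u \<in> FL. t \<subseteq> u \<and> u \<subseteq> T} - {u \<in> FL. t \<subseteq> u \<and> u \<subseteq> T \<and> \<not> u \<subseteq> s}"
    then have "cl (u \<union> s) \<subseteq> s" using join_iff[of u s s] sF flat_subset by auto
    then show "mu t u * ?f (cl (u \<union> s)) = 0" by simp
  next
    fix u assume u: "u \<in> {u \<in> FL. t \<subseteq> u \<and> u \<subseteq> T \<and> \<not> u \<subseteq> s}"
    then have "u \<in> V" by (auto simp: V_iff)
    moreover have "\<not> cl (u \<union> s) \<subseteq> s" using u join_iff[of u s s] sF flat_subset by auto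
    ultimately show "mu t u * of_bool (max_tight T s (Poly_Mapping.single u 1 + m)) =
        mu t u * ?f (cl (u \<union> s))"
      using max_tight_join[OF s _ _ T, of u m] u by auto
  qed auto
  also have "\<dots> = 0"
    by (rule mu_sum_join) (use s T t sF in auto)
  finally show ?thesis .
qed

lemma good_add_single:
  assumes "u \<in> V" "T \<in> FL"
  shows "good T (Poly_Mapping.single u 1 + m) \<longleftrightarrow>
    good T m \<and> (\<forall>F\<in>V. u \<subseteq> F \<and> F \<subseteq> T \<longrightarrow> cnt m F + 1 < cd F)"
  using assms by (auto simp: good_def cnt_add cnt_single split: if_splits)

text \<open>For good \<open>m\<close>, the extra factor \<open>u\<close> violates the condition
  exactly when \<open>u\<close> lies below a tight flat. If there are tight flats between
  \<open>s\<close> and \<open>T\<close>, they have a largest one \<open>F0\<close>, so the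
  \<open>u\<close> to discard form the interval from \<open>s\<close> to \<open>F0\<close>. The
  Moebius sums over this interval and over the whole one are the indicators of \<open>s = F0\<close>
  and \<open>s = T\<close>.\<close>

lemma sum_mu_good:
  assumes s: "s \<in> V" "s \<subseteq> T" and T: "T \<in> FL"
  shows "- (\<Sum>u\<in>{u \<in> FL. s \<subseteq> u \<and> u \<subseteq> T}. mu s u * of_bool (good T (Poly_Mapping.single u 1 + m))) =
    of_bool (max_tight T s m) - of_bool (s = T \<and> good T m)"
proof (cases "good T m")
  case False
  have "\<not> good T (Poly_Mapping.single u 1 + m)" if "u \<in> FL" "s \<subseteq> u" for u
    using good_add_single[OF _ T, of u m] that s False by (auto simp: V_iff)
  then have "(\<Sum>u\<in>{u \<in> FL. s \<subseteq> u \<and> u \<subseteq> T}. mu s u * of_bool (good T (Poly_Mapping.single u 1 + m))) = 0"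
    by (intro sum.neutral) auto
  then show ?thesis using False by (simp add: max_tight_def)
next
  case True
  let ?I = "{u \<in> FL. s \<subseteq> u \<and> u \<subseteq> T}"
  let ?X = "{F \<in> ?I. cnt m F + 1 = cd F}"
  have sF: "s \<in> FL" using s by (simp add: V_iff)
  have IV: "u \<in> V" if "u \<in> ?I" for u using that s by (auto simp: V_iff)
  have lt: "cnt m F < cd F" if "F \<in> ?I" for F using True IV that by (auto simp: good_def)
  have lt_iff: "cnt m F + 1 < cd F \<longleftrightarrow> F \<notin> ?X" if "F \<in> ?I" for F
    using lt[OF that] that by auto
  have all: "(\<Sum>u\<in>?I. mu s u) = of_bool (s = T)"
    using mu_sum_right[OF sF T s(2)] .
  have good_iff: "good T (Poly_Mapping.single u 1 + m) \<longleftrightarrow> \<not> (\<exists>F\<in>?X. u \<subseteq> F)" if u: "u \<in> ?I" for u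
  proof -
    have "(\<forall>F\<in>V. u \<subseteq> F \<and> F \<subseteq> T \<longrightarrow> cnt m F + 1 < cd F) \<longleftrightarrow>
        (\<forall>F\<in>?I. u \<subseteq> F \<longrightarrow> cnt m F + 1 < cd F)"
      using u IV by (auto simp: V_iff)
    also have "\<dots> \<longleftrightarrow> \<not> (\<exists>F\<in>?X. u \<subseteq> F)"
      using lt_iff by blast
    finally show ?thesis using good_add_single[OF IV[OF u] T] True by simp
  qed
  have tight_iff: "max_tight T s m \<longleftrightarrow> s \<in> ?X \<and> (\<forall>F\<in>?X. \<not> s \<subset> F)"
  proof -
    have "F \<in> V \<and> s \<subset> F \<and> F \<subseteq> T \<longleftrightarrow> F \<in> ?I \<and> s \<subset> F" for F
      using IV[of F] V_iff[of F] by blast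
    then have "(\<forall>F\<in>V. s \<subset> F \<and> F \<subseteq> T \<longrightarrow> cnt m F + 1 < cd F) \<longleftrightarrow> (\<forall>F\<in>?I. s \<subset> F \<longrightarrow> cnt m F + 1 < cd F)"
      by meson
    also have "\<dots> \<longleftrightarrow> (\<forall>F\<in>?X. \<not> s \<subset> F)" using lt_iff by blast
    finally have "max_tight T s m \<longleftrightarrow> cnt m s + 1 = cd s \<and> (\<forall>F\<in>?X. \<not> s \<subset> F)"
      using True by (simp only: max_tight_def simp_thms)
    moreover have "cnt m s + 1 = cd s \<longleftrightarrow> s \<in> ?X" using s sF by simp
    ultimately show ?thesis by simp
  qed
  show ?thesis
  proof (cases "?X = {}")
    case X: True
    have "good T (Poly_Mapping.single u 1 + m)" if "u \<in> ?I" for u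
      using good_iff[OF that] X by blast
    then have "(\<Sum>u\<in>?I. mu s u * of_bool (good T (Poly_Mapping.single u 1 + m))) = (\<Sum>u\<in>?I. mu s u)"
      by (intro sum.cong refl) simp
    moreover have "\<not> max_tight T s m" using tight_iff X by blast
    ultimately show ?thesis using all True by simp
  next
    case False
    have "finite ?X" by simp
    from finite_has_maximal[OF this False]
    obtain F0 where F0: "F0 \<in> ?X" and F0_max: "\<forall>F\<in>?X. F0 \<subseteq> F \<longrightarrow> F0 = F" ..
    \<comment> \<open>Both flats contain \<open>s\<close>, so their intersection is nonempty and has
      defect at least 1, as has the join. The defects of \<open>F\<close> and \<open>F0\<close> are
      1, so submodularity makes the join tight, and maximality of \<open>F0\<close> absorbs
      \<open>F\<close>.\<close>
    have X_sub: "F \<subseteq> F0" if F: "F \<in> ?X" for F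
    proof -
      have fl: "F \<in> FL" "F0 \<in> FL" using F F0 by auto
      let ?J = "cl (F \<union> F0)"
      have "F \<inter> F0 \<in> ?I" "?J \<in> ?I"
        using flat_Int[OF fl] F F0 join_flat[OF fl] join_upper[OF fl] join_iff[of F F0 T] T
          flat_subset[OF fl(1)] flat_subset[OF fl(2)]
        by auto
      then have "cnt m (F \<inter> F0) < cd (F \<inter> F0)" "cnt m ?J < cd ?J" by (simp_all only: lt)
      moreover have "cnt m F + 1 = cd F" "cnt m F0 + 1 = cd F0" using F F0 by auto
      ultimately have "cnt m ?J + 1 = cd ?J"
        using cnt_supermodular[OF fl, of m] cd_join[OF fl] by linarith
      then have "?J \<in> ?X" using \<open>?J \<in> ?I\<close> by simp
      then show ?thesis using F0_max join_upper[OF fl] by blast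
    qed
    let ?K = "{u \<in> FL. s \<subseteq> u \<and> u \<subseteq> F0}"
    have K: "?K \<subseteq> ?I" using F0 by auto
    have "(\<Sum>u\<in>?I. mu s u * of_bool (good T (Poly_Mapping.single u 1 + m))) = (\<Sum>u\<in>?I - ?K. mu s u)"
    proof (rule sum.mono_neutral_cong_right; (intro ballI)?)
      fix u assume "u \<in> ?I - (?I - ?K)"
      then have "\<not> good T (Poly_Mapping.single u 1 + m)"
        using good_iff[of u] F0 by blast
      then show "mu s u * of_bool (good T (Poly_Mapping.single u 1 + m)) = 0" by simp
    next
      fix u assume u: "u \<in> ?I - ?K"
      then have "good T (Poly_Mapping.single u 1 + m)"
        using good_iff[of u] X_sub by blast
      then show "mu s u * of_bool (good T (Poly_Mapping.single u 1 + m)) = mu s u" by simp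
    qed auto
    also have "\<dots> = of_bool (s = T) - (\<Sum>u\<in>?K. mu s u)"
      using sum_diff[OF _ K, of "mu s"] all by simp
    also have "(\<Sum>u\<in>?K. mu s u) = of_bool (s = F0)"
      using F0 by (intro mu_sum_right[OF sF]) auto
    finally have "(\<Sum>u\<in>?I. mu s u * of_bool (good T (Poly_Mapping.single u 1 + m))) =
      of_bool (s = T) - of_bool (s = F0)" .
    moreover have "max_tight T s m \<longleftrightarrow> s = F0"
      using tight_iff F0 X_sub by blast
    ultimately show ?thesis using True by simp
  qed
qed

text \<open>The \<open>b\<close> factors \<open>g\<close> count at \<open>g\<close> but not at
  \<open>s\<close>. Tightness at \<open>s\<close> thus pushes the count at \<open>g\<close> up to at
  least \<open>cd s - 1 + b\<close>, hence to \<open>cd g - 1\<close>, against maximality of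
  \<open>s\<close>.\<close>

lemma not_max_tight_power:
  assumes s: "s \<in> V" and g: "g \<in> V" "s \<subset> g" "g \<subseteq> T" and b: "cd g \<le> b + cd s"
  shows "\<not> max_tight T s (Poly_Mapping.single g b + m)"
proof
  let ?m = "Poly_Mapping.single g b + m"
  assume "max_tight T s ?m"
  then have "cnt ?m s + 1 = cd s" "cnt ?m g + 1 < cd g"
    using g by (auto simp: max_tight_def)
  moreover have "cnt m s \<le> cnt m g"
    unfolding cnt_def using g by (intro sum_mono2) auto
  moreover have "\<not> g \<subseteq> s" using g by blast
  ultimately show False using b g by (simp add: cnt_add cnt_single)
qed

lemma not_good_power:
  assumes "g \<in> V" "g \<subseteq> T" "cd g \<le> b"
  shows "\<not> good T (Poly_Mapping.single g b + m)"
  using assms by (auto simp: good_def cnt_add cnt_single intro!: bexI[of _ g])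

end

section \<open>The degree functional\<close>

lemma linear_functional_var_mult:
  "linear_functional f (mp_var u * p) = linear_functional (\<lambda>m. f (Poly_Mapping.single u 1 + m)) p"
  by (simp add: rat_scalar.linear_extension_mult mp_var_def)

lemma linear_functional_var_power_mult:
  "linear_functional f (mp_var u ^ k * p) = linear_functional (\<lambda>m. f (Poly_Mapping.single u k + m)) p"
  by (simp add: rat_scalar.linear_extension_mult mp_var_power)

lemma linear_functional_linear_form_mult:
  "linear_functional f ((\<Sum>u\<in>A. mp_const (c u) * mp_var u) * p) =
    linear_functional (\<lambda>m. \<Sum>u\<in>A. c u * f (Poly_Mapping.single u 1 + m)) p"
  by (simp add: sum_distrib_right rat_scalar.linear_extension_sum mult.assoc
      linear_functional_const_mult linear_functional_var_mult linear_functional_sum_fun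
      linear_functional_scale_fun)

context loopless_polymatroid
begin

abbreviation functional :: "'a set \<Rightarrow> 'a set rat_mpoly \<Rightarrow> rat" where
  "functional T \<equiv> linear_functional (\<lambda>m. of_bool (good T m))"

abbreviation tight_functional :: "'a set \<Rightarrow> 'a set \<Rightarrow> 'a set rat_mpoly \<Rightarrow> rat" where
  "tight_functional T s \<equiv> linear_functional (\<lambda>m. of_bool (max_tight T s m))"

text \<open>\<open>X g\<close> is the expansion of the generator \<open>x\<^sub>g\<close> in the \<open>h\<^sub>u\<close>: the variable \<open>mp_var u\<close> stands for
  \<open>h\<^sub>u\<close> in the target of \<open>substitution X\<close>, but for \<open>x\<^sub>u\<close> in its source.\<close>

definition X :: "'a set \<Rightarrow> 'a set rat_mpoly" where
  "X g = - (\<Sum>u\<in>{u \<in> FL. g \<subseteq> u}. mp_const (mu g u) * mp_var u)"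

text \<open>The range is written as an interval ending at \<open>E\<close>, the form of
  \<open>sum_mu_good\<close> and \<open>max_tight_sum_zero\<close> for \<open>T = E\<close>.\<close>

lemma linear_functional_X_mult:
  "linear_functional f (X s * p) =
    linear_functional (\<lambda>m. - (\<Sum>u\<in>{u \<in> FL. s \<subseteq> u \<and> u \<subseteq> E}. mu s u * f (Poly_Mapping.single u 1 + m))) p"
proof -
  have "{u \<in> FL. s \<subseteq> u \<and> u \<subseteq> E} = {u \<in> FL. s \<subseteq> u}" using flat_subset by auto
  moreover have "linear_functional (\<lambda>m. - g m) p = - linear_functional g p" for g :: "('a set \<Rightarrow>\<^sub>0 nat) \<Rightarrow> rat"
    using linear_functional_scale_fun[of "-1" g p] by simp
  ultimately show ?thesis
    by (simp add: X_def rat_scalar.linear_extension_uminus linear_functional_linear_form_mult)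
qed

lemma functional_X_mult:
  assumes "s \<in> V" "s \<noteq> E"
  shows "functional E (X s * p) = tight_functional E s p"
proof -
  have sE: "s \<subseteq> E" using assms flat_subset by (auto simp: V_iff)
  show ?thesis
    unfolding linear_functional_X_mult sum_mu_good[OF assms(1) sE ground_flat] using assms by simp
qed

text \<open>The factor \<open>X s\<close> turns the functional into the indicator of
  \<open>max_tight\<close>. No flat above \<open>t\<close> lies below \<open>s\<close>, so the
  expansion of \<open>X t\<close> is exactly a sum killed by
  \<open>max_tight_sum_zero\<close>.\<close>

lemma functional_X_X:
  assumes s: "s \<in> V" and t: "t \<in> V" and "\<not> s \<subseteq> t" "\<not> t \<subseteq> s"
  shows "functional E (X s * (X t * p)) = 0"
proof -
  have tE: "t \<subseteq> E" "s \<subseteq> E" using s t flat_subset by (auto simp: V_iff)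
  then have "s \<noteq> E" using assms by auto
  have "{u \<in> FL. t \<subseteq> u \<and> u \<subseteq> E} = {u \<in> FL. t \<subseteq> u \<and> u \<subseteq> E \<and> \<not> u \<subseteq> s}"
    using assms by auto
  then have "(\<Sum>u\<in>{u \<in> FL. t \<subseteq> u \<and> u \<subseteq> E}. mu t u * of_bool (max_tight E s (Poly_Mapping.single u 1 + m))) = 0"
    for m
    using max_tight_sum_zero[OF s tE(2) ground_flat, of t m] assms by (simp add: V_iff)
  then have "tight_functional E s (X t * p) = linear_functional (\<lambda>m. - 0) p"
    by (simp only: linear_functional_X_mult)
  then show ?thesis
    using functional_X_mult[OF s \<open>s \<noteq> E\<close>] by (simp add: linear_extension_def)
qed

lemma functional_X_power:
  assumes s: "s \<in> V" and g: "g \<in> V" "s \<subset> g" and b: "cd g \<le> b + cd s"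
  shows "functional E (X s * (mp_var g ^ b * p)) = 0"
proof -
  have "g \<subseteq> E" using g flat_subset by (auto simp: V_iff)
  then have "s \<noteq> E" "\<And>m. \<not> max_tight E s (Poly_Mapping.single g b + m)"
    using not_max_tight_power[OF s g] b g by auto
  then show ?thesis
    by (simp add: functional_X_mult[OF s] linear_functional_var_power_mult)
      (simp add: linear_extension_def)
qed

lemma functional_power:
  assumes g: "g \<in> V" and b: "cd g \<le> b"
  shows "functional E (mp_var g ^ b * p) = 0"
proof -
  have "g \<subseteq> E" using g flat_subset by (auto simp: V_iff)
  then have "\<And>m. \<not> good E (Poly_Mapping.single g b + m)"
    using not_good_power[OF g _ b] by auto
  then show ?thesis
    by (simp add: linear_functional_var_power_mult) (simp add: linear_extension_def)
qed

text \<open>Moebius inversion: after exchanging the sums, \<open>mu_sum_left\<close> leaves only the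
  term \<open>u = g\<close>. The power in each defining relation thereby becomes a power of a single
  variable, up to sign.\<close>

lemma substitution_upper_sum:
  assumes g: "g \<in> V"
  shows "substitution X (\<Sum>h\<in>{h \<in> V. g \<subseteq> h}. mp_var h) = - mp_var g"
proof -
  let ?U = "{u \<in> FL. g \<subseteq> u}"
  have gF: "g \<in> FL" using g by (simp add: V_iff)
  have U: "{h \<in> V. g \<subseteq> h} = ?U" using g by (auto simp: V_iff)
  have "(\<Sum>h\<in>?U. X h) = - (\<Sum>h\<in>?U. \<Sum>u\<in>?U. mp_const (of_bool (h \<subseteq> u) * mu h u) * mp_var u)"
    unfolding X_def sum_negf
    by (intro arg_cong[of _ _ uminus] sum.cong refl sum.mono_neutral_cong_left)
      (auto simp: const_scalar.scalar_zero)
  also have "\<dots> = - (\<Sum>u\<in>?U. \<Sum>h\<in>?U. mp_const (of_bool (h \<subseteq> u) * mu h u) * mp_var u)"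
    by (subst sum.swap) simp
  also have "\<dots> = - (\<Sum>u\<in>?U. of_bool (u = g) * mp_var u)"
  proof (intro arg_cong[of _ _ uminus] sum.cong refl)
    fix u assume u: "u \<in> ?U"
    have "(\<Sum>h\<in>?U. of_bool (h \<subseteq> u) * mu h u) = (\<Sum>h\<in>{h \<in> FL. g \<subseteq> h \<and> h \<subseteq> u}. mu h u)"
      by (intro sum.mono_neutral_cong_right) auto
    also have "\<dots> = of_bool (g = u)" using u gF by (intro mu_sum_left) auto
    finally have "(\<Sum>h\<in>?U. of_bool (h \<subseteq> u) * mu h u) = of_bool (g = u)" .
    then show "(\<Sum>h\<in>?U. mp_const (of_bool (h \<subseteq> u) * mu h u) * mp_var u) = of_bool (u = g) * mp_var u"
      by (simp only: sum_distrib_right[symmetric] const_scalar.scalar_sum)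
        (auto simp: const_scalar.scalar_zero const_scalar.scalar_one)
  qed
  also have "\<dots> = - mp_var g" using gF by (simp add: of_bool_def if_distrib[of "\<lambda>x. x * _"] sum.delta cong: if_cong)
  finally show ?thesis by (simp add: substitution_sum substitution_var U)
qed

section \<open>The functional on the defining relations\<close>

definition chow_functional :: "'a set rat_mpoly \<Rightarrow> rat" where
  "chow_functional p = functional E (substitution X p)"

text \<open>Two incomparable members of \<open>S\<close> already give 0. If \<open>S\<close> is a
  chain, the join of its members below \<open>g\<close> is the largest of them, and
  \<open>functional_X_power\<close> applies to that one; if there are none, the join is empty and
  the power of \<open>g\<close> alone violates the counting condition.\<close>

lemma chow_functional_relation:
  assumes S: "S \<subseteq> V" and g: "g \<in> V"
    and b: "cd g \<le> b + cd (\<Squnion>\<^bsub>flat_lattice E cd\<^esub> {s \<in> S. s \<subset> g})"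
  shows "chow_functional ((\<Prod>s\<in>S. mp_var s) * (\<Sum>h\<in>{h \<in> V. g \<subseteq> h}. mp_var h) ^ b * q) = 0"
proof -
  have fin: "finite S" using S finite_V finite_subset by blast
  define Q where "Q = substitution X q"
  have eq: "chow_functional ((\<Prod>s\<in>S. mp_var s) * (\<Sum>h\<in>{h \<in> V. g \<subseteq> h}. mp_var h) ^ b * q) =
      functional E ((\<Prod>s\<in>S. X s) * (- mp_var g) ^ b * Q)"
    unfolding chow_functional_def substitution_mult substitution_prod substitution_power
      substitution_var substitution_upper_sum[OF g] Q_def ..
  have neg: "(- mp_var g) ^ b = (mp_var g :: 'a set rat_mpoly) ^ b * (-1) ^ b"
    by (metis mult.commute power_minus)
  show ?thesis
  proof (cases "\<exists>s\<in>S. \<exists>t\<in>S. \<not> s \<subseteq> t \<and> \<not> t \<subseteq> s")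
    case True
    then obtain s t where st: "s \<in> S" "t \<in> S" "\<not> s \<subseteq> t" "\<not> t \<subseteq> s" by blast
    then have "s \<noteq> t" by auto
    have "(\<Prod>s\<in>S. X s) = X s * (X t * (\<Prod>s\<in>S - {s} - {t}. X s))"
      using prod.remove[of S s X] prod.remove[of "S - {s}" t X] fin st \<open>s \<noteq> t\<close> by simp
    then have "(\<Prod>s\<in>S. X s) * (- mp_var g) ^ b * Q =
        X s * (X t * ((\<Prod>s\<in>S - {s} - {t}. X s) * (- mp_var g) ^ b * Q))"
      by (simp only: mult.assoc)
    moreover have "s \<in> V" "t \<in> V" using st S by auto
    ultimately show ?thesis using functional_X_X[of s t] st eq by simp
  next
    case chain: False
    let ?S = "{s \<in> S. s \<subset> g}"
    show ?thesis
    proof (cases "?S = {}")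
      case True
      then have "cd g \<le> b" using b unfolding True by (simp add: sup_flats_empty cd_empty)
      moreover have "(\<Prod>s\<in>S. X s) * (- mp_var g) ^ b * Q =
          mp_var g ^ b * ((-1) ^ b * (\<Prod>s\<in>S. X s) * Q)"
        by (simp only: neg mult_ac)
      ultimately show ?thesis using functional_power[OF g] eq by simp
    next
      case False
      have "finite ?S" using fin by simp
      from finite_has_maximal[OF this False]
      obtain s where s: "s \<in> ?S" and "\<forall>t\<in>?S. s \<subseteq> t \<longrightarrow> s = t" ..
      then have "\<forall>t\<in>?S. t \<subseteq> s" using chain by blast
      then have "\<Squnion>\<^bsub>flat_lattice E cd\<^esub> ?S = s"
        using s S by (intro sup_flats_greatest) (auto simp: V_iff)
      then have "cd g \<le> b + cd s" using b by simp
      moreover have "(\<Prod>s\<in>S. X s) = X s * (\<Prod>s\<in>S - {s}. X s)"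
        using fin s by (simp add: prod.remove)
      then have "(\<Prod>s\<in>S. X s) * (- mp_var g) ^ b * Q =
          X s * (mp_var g ^ b * ((-1) ^ b * (\<Prod>s\<in>S - {s}. X s) * Q))"
        by (simp only: neg mult_ac)
      moreover have "s \<in> V" using s S by auto
      ultimately show ?thesis using functional_X_power[of s g b] g s eq by simp
    qed
  qed
qed

section \<open>The values on powers of \<open>\<beta>\<close>\<close>

text \<open>\<open>B E\<close> is the image of \<beta> under \<open>substitution X\<close>; the
  other \<open>B T\<close> are its analogues for the intervals below \<open>T\<close>.\<close>

definition B :: "'a set \<Rightarrow> 'a set rat_mpoly" where
  "B T = (\<Sum>u\<in>{u \<in> V. u \<subseteq> T}. mp_const (mu {} u) * mp_var u)"

lemma V_sum_mu_left:
  assumes "u \<in> V"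
  shows "(\<Sum>s\<in>{s \<in> V. s \<subseteq> u}. mu s u) = - mu {} u"
proof -
  have "{z \<in> FL. {} \<subseteq> z \<and> z \<subseteq> u} = insert {} {s \<in> V. s \<subseteq> u}"
    using empty_flat by (auto simp: V_iff)
  then have "mu {} u + (\<Sum>s\<in>{s \<in> V. s \<subseteq> u}. mu s u) = 0"
    using mu_sum_left[OF empty_flat, of u] assms by (auto simp: V_iff)
  then show ?thesis by simp
qed

text \<open>This evaluates one factor \<open>B T\<close>. Writing \<open>mu {} u\<close> as minus
  the sum of \<open>mu s u\<close> over nonempty \<open>s\<close> below \<open>u\<close> and
  exchanging the sums leads to \<open>sum_mu_good\<close> for each \<open>s\<close>; only
  \<open>s = T\<close> contributes a correction.\<close>

lemma sum_mu_bottom_good: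
  assumes T: "T \<in> V"
  shows "(\<Sum>u\<in>{u \<in> V. u \<subseteq> T}. mu {} u * of_bool (good T (Poly_Mapping.single u 1 + m))) =
    (\<Sum>s\<in>{s \<in> V. s \<subseteq> T}. of_bool (max_tight T s m)) - of_bool (good T m)"
proof -
  let ?A = "{u \<in> V. u \<subseteq> T}" and ?g = "\<lambda>u. of_bool (good T (Poly_Mapping.single u 1 + m)) :: rat"
  have TF: "T \<in> FL" using T by (simp add: V_iff)
  have "(\<Sum>u\<in>?A. mu {} u * ?g u) = - (\<Sum>u\<in>?A. \<Sum>s\<in>{s \<in> V. s \<subseteq> u}. mu s u * ?g u)"
    by (simp add: V_sum_mu_left sum_distrib_right[symmetric] sum_negf)
  also have "\<dots> = - (\<Sum>u\<in>?A. \<Sum>s\<in>?A. of_bool (s \<subseteq> u) * (mu s u * ?g u))"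
    by (intro arg_cong[of _ _ uminus] sum.cong refl sum.mono_neutral_cong_left) auto
  also have "\<dots> = - (\<Sum>s\<in>?A. \<Sum>u\<in>?A. of_bool (s \<subseteq> u) * (mu s u * ?g u))"
    by (subst sum.swap) simp
  also have "\<dots> = (\<Sum>s\<in>?A. - (\<Sum>u\<in>{u \<in> FL. s \<subseteq> u \<and> u \<subseteq> T}. mu s u * ?g u))"
    unfolding sum_negf
    by (intro arg_cong[of _ _ uminus] sum.cong refl sum.mono_neutral_cong_right) (auto simp: V_iff)
  also have "\<dots> = (\<Sum>s\<in>?A. of_bool (max_tight T s m) - of_bool (s = T \<and> good T m))"
    by (intro sum.cong refl sum_mu_good TF) auto
  also have "\<dots> = (\<Sum>s\<in>?A. of_bool (max_tight T s m)) - (\<Sum>s\<in>?A. of_bool (s = T) * of_bool (good T m))"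
    by (simp add: sum_subtractf of_bool_conj)
  also have "(\<Sum>s\<in>?A. of_bool (s = T) * of_bool (good T m)) = (of_bool (good T m) :: rat)"
    using T by (simp add: sum_distrib_right[symmetric] of_bool_def sum.delta)
  finally show ?thesis .
qed

text \<open>The terms of \<open>B T\<close> with \<open>u\<close> not below \<open>s\<close> cancel
  by \<open>max_tight_sum_zero\<close> with \<open>t\<close> the empty flat.\<close>

lemma tight_functional_B_mult:
  assumes s: "s \<in> V" "s \<subseteq> T" and T: "T \<in> FL"
  shows "tight_functional T s (B T * p) = tight_functional T s (B s * p)"
proof -
  have "(\<Sum>u\<in>{u \<in> V. u \<subseteq> T}. mu {} u * of_bool (max_tight T s (Poly_Mapping.single u 1 + m))) =
    (\<Sum>u\<in>{u \<in> V. u \<subseteq> s}. mu {} u * of_bool (max_tight T s (Poly_Mapping.single u 1 + m)))" for m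
  proof -
    let ?C = "{u \<in> FL. {} \<subseteq> u \<and> u \<subseteq> T \<and> \<not> u \<subseteq> s}"
    have "{u \<in> V. u \<subseteq> T} = {u \<in> V. u \<subseteq> s} \<union> ?C" "{u \<in> V. u \<subseteq> s} \<inter> ?C = {}"
      using s by (auto simp: V_iff)
    moreover have "finite {u \<in> V. u \<subseteq> s}" "finite ?C" by simp_all
    moreover have "\<not> s \<subseteq> {}" using s by (simp add: V_iff)
    ultimately show ?thesis
      using max_tight_sum_zero[OF s T empty_flat, of m]
      by (simp only: sum.union_disjoint add_0_right not_False_eq_True simp_thms)
  qed
  then show ?thesis by (simp only: B_def linear_functional_linear_form_mult)
qed

text \<open>The cofactor \<open>p\<close> stays arbitrary in the induction so that a factor already
  replaced by \<open>B s\<close> can be moved into it.\<close>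

lemma tight_functional_B_power:
  assumes s: "s \<in> V" "s \<subseteq> T" and T: "T \<in> FL"
  shows "tight_functional T s (B T ^ k * p) = tight_functional T s (B s ^ k * p)"
proof (induction k arbitrary: p)
  case (Suc k)
  have "tight_functional T s (B T ^ Suc k * p) = tight_functional T s (B s * (B T ^ k * p))"
    using tight_functional_B_mult[OF s T, of "B T ^ k * p"] by (simp add: mult.assoc)
  also have "\<dots> = tight_functional T s (B s ^ k * (B s * p))"
    using Suc.IH[of "B s * p"] by (simp only: mult.left_commute)
  finally show ?case by (simp add: mult_ac)
qed simp

lemma cnt_keys_B_power:
  assumes "m \<in> Poly_Mapping.keys (B s ^ k)" "s \<subseteq> F"
  shows "cnt m F = k"
  using assms(1)
proof (induction k arbitrary: m)
  case (Suc k)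
  then obtain a b where m: "m = a + b" and a: "a \<in> Poly_Mapping.keys (B s)"
      and b: "b \<in> Poly_Mapping.keys (B s ^ k)"
    using keys_mult[of "B s" "B s ^ k"] by auto
  have "mp_const c * mp_var u = Poly_Mapping.single (Poly_Mapping.single u 1) c" for c and u :: "'a set"
    by (simp add: mp_const_def mp_var_def mult_single)
  then have "Poly_Mapping.keys (B s) \<subseteq> (\<Union>u\<in>{u \<in> V. u \<subseteq> s}. {Poly_Mapping.single u 1})"
    unfolding B_def by (intro order_trans[OF keys_sum] UN_mono) auto
  then have "cnt a F = 1" using a assms(2) by (auto simp: cnt_single)
  then show ?case using Suc.IH[OF b] by (simp add: m cnt_add)
qed simp

text \<open>All monomials of \<open>B s ^ k\<close> have count \<open>k\<close> at every flat
  containing \<open>s\<close>. Tightness at \<open>s\<close> therefore means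
  \<open>k + 1 = cd s\<close>, and strict growth of \<open>cd\<close> then rules out larger tight
  flats.\<close>

lemma tight_functional_B_power_eq:
  assumes s: "s \<in> V" "s \<subseteq> T" and T: "T \<in> FL"
  shows "tight_functional T s (B T ^ k) = of_bool (k + 1 = cd s) * functional s (B s ^ k)"
proof -
  have "tight_functional T s (B T ^ k) = tight_functional T s (B s ^ k)"
    using tight_functional_B_power[OF s T, of k 1] by simp
  also have "\<dots> = linear_functional (\<lambda>m. of_bool (k + 1 = cd s) * of_bool (good s m)) (B s ^ k)"
  proof (rule rat_scalar.linear_extension_cong)
    fix m assume m: "m \<in> Poly_Mapping.keys (B s ^ k)"
    have "k + 1 < cd F" if "F \<in> V" "s \<subset> F" "k + 1 = cd s" for F
      using flat_cd_strict[of s F] that s by (simp add: V_iff)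
    then have "max_tight T s m \<longleftrightarrow> k + 1 = cd s \<and> good s m"
      unfolding max_tight_iff[OF s T] using cnt_keys_B_power[OF m] by (metis psubset_imp_subset subset_refl)
    then show "of_bool (max_tight T s m) = of_bool (k + 1 = cd s) * (of_bool (good s m) :: rat)"
      by simp
  qed
  finally show ?thesis by (simp only: linear_functional_scale_fun)
qed

lemma functional_B_power_Suc:
  assumes T: "T \<in> V"
  shows "functional T (B T ^ Suc k) =
    (\<Sum>s\<in>{s \<in> V. s \<subseteq> T}. of_bool (k + 1 = cd s) * functional s (B s ^ k)) - functional T (B T ^ k)"
proof -
  have TF: "T \<in> FL" using T by (simp add: V_iff)
  have "functional T (B T ^ Suc k) = linear_functional (\<lambda>m.
      (\<Sum>s\<in>{s \<in> V. s \<subseteq> T}. of_bool (max_tight T s m)) + (-1) * of_bool (good T m)) (B T ^ k)"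
    unfolding power_Suc
    by (subst (1) B_def)
      (simp only: linear_functional_linear_form_mult sum_mu_bottom_good[OF T] mult_minus1 diff_conv_add_uminus)
  also have "\<dots> = (\<Sum>s\<in>{s \<in> V. s \<subseteq> T}. tight_functional T s (B T ^ k)) - functional T (B T ^ k)"
    unfolding linear_functional_add_fun linear_functional_sum_fun linear_functional_scale_fun by simp
  also have "(\<Sum>s\<in>{s \<in> V. s \<subseteq> T}. tight_functional T s (B T ^ k)) =
      (\<Sum>s\<in>{s \<in> V. s \<subseteq> T}. of_bool (k + 1 = cd s) * functional s (B s ^ k))"
    by (intro sum.cong refl tight_functional_B_power_eq TF) auto
  finally show ?thesis .
qed

lemma functional_B_power:
  assumes "T \<in> V"
  shows "functional T (B T ^ k) = (-1) ^ k * (\<Sum>g\<in>{g \<in> FL. g \<subseteq> T \<and> cd g \<le> k}. mu {} g)"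
  using assms
proof (induction k arbitrary: T)
  case 0
  have "g \<in> FL \<and> g \<subseteq> T \<and> cd g \<le> 0 \<longleftrightarrow> g = {}" for g
    using cd_V_pos[of g] empty_flat V_iff[of g] cd_empty by fastforce
  then have "{g \<in> FL. g \<subseteq> T \<and> cd g \<le> 0} = {{}}" by simp
  moreover have "good T 0" using cd_V_pos by (simp add: good_def)
  ultimately show ?case
    using mu_refl[OF empty_flat] rat_scalar.linear_extension_single[of "\<lambda>m. of_bool (good T m)" 0 1]
    by simp
next
  case (Suc k)
  let ?S = "{s \<in> V. s \<subseteq> T}"
  \<comment> \<open>Since \<open>cd s = k + 1\<close>, the flats below \<open>s\<close> with
    \<open>cd\<close> at most \<open>k\<close> are all except \<open>s\<close> itself, so their
    Moebius sum is \<open>- mu {} s\<close>.\<close>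
  have top: "functional s (B s ^ k) = (-1) ^ Suc k * mu {} s" if s: "s \<in> V" "k + 1 = cd s" for s
  proof -
    have sF: "s \<in> FL" "s \<noteq> {}" using s by (auto simp: V_iff)
    have "cd g \<le> k \<longleftrightarrow> g \<noteq> s" if "g \<in> FL" "g \<subseteq> s" for g
      using flat_cd_strict[of g s] s that sF by (cases "g = s") (simp_all add: psubset_eq)
    then have "{g \<in> FL. {} \<subseteq> g \<and> g \<subseteq> s} = insert s {g \<in> FL. g \<subseteq> s \<and> cd g \<le> k}"
      using sF by auto
    moreover have "s \<notin> {g \<in> FL. g \<subseteq> s \<and> cd g \<le> k}" using s by auto
    ultimately have "mu {} s + (\<Sum>g\<in>{g \<in> FL. g \<subseteq> s \<and> cd g \<le> k}. mu {} g) = 0"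
      using mu_sum_right[OF empty_flat sF(1)] sF by simp
    then have "(\<Sum>g\<in>{g \<in> FL. g \<subseteq> s \<and> cd g \<le> k}. mu {} g) = - mu {} s" by linarith
    then show ?thesis using Suc.IH[OF s(1)] by simp
  qed
  have "(\<Sum>s\<in>?S. of_bool (k + 1 = cd s) * functional s (B s ^ k)) =
      (\<Sum>s\<in>?S. of_bool (k + 1 = cd s) * ((-1) ^ Suc k * mu {} s))"
  proof (rule sum.cong[OF refl])
    fix s assume "s \<in> ?S"
    then show "of_bool (k + 1 = cd s) * functional s (B s ^ k) =
        of_bool (k + 1 = cd s) * ((-1) ^ Suc k * mu {} s)"
      using top[of s] by (cases "k + 1 = cd s") (simp_all only: of_bool_eq mem_Collect_eq simp_thms mult_zero_left)
  qed
  also have "\<dots> = (\<Sum>s\<in>{s \<in> FL. s \<subseteq> T \<and> cd s = Suc k}. (-1) ^ Suc k * mu {} s)"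
    by (intro sum.mono_neutral_cong_right) (auto simp: V_iff cd_empty)
  finally have tight: "(\<Sum>s\<in>?S. of_bool (k + 1 = cd s) * functional s (B s ^ k)) =
      (-1) ^ Suc k * (\<Sum>s\<in>{s \<in> FL. s \<subseteq> T \<and> cd s = Suc k}. mu {} s)"
    by (simp only: sum_distrib_left)
  have "{g \<in> FL. g \<subseteq> T \<and> cd g \<le> Suc k} =
      {s \<in> FL. s \<subseteq> T \<and> cd s = Suc k} \<union> {g \<in> FL. g \<subseteq> T \<and> cd g \<le> k}"
    by auto
  then have "(\<Sum>g\<in>{g \<in> FL. g \<subseteq> T \<and> cd g \<le> Suc k}. mu {} g) =
      (\<Sum>s\<in>{s \<in> FL. s \<subseteq> T \<and> cd s = Suc k}. mu {} s) + (\<Sum>g\<in>{g \<in> FL. g \<subseteq> T \<and> cd g \<le> k}. mu {} g)"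
    by (simp only:) (rule sum.union_disjoint, auto)
  then show ?case
    unfolding functional_B_power_Suc[OF Suc.prems] tight Suc.IH[OF Suc.prems]
    by (simp add: algebra_simps)
qed

text \<open>Factors \<open>E\<close> are counted only at the flat \<open>E\<close>, where the total
  \<open>i + k\<close> stays below \<open>cd E\<close>; at smaller flats nothing changes.\<close>

lemma functional_ground_power_mult:
  assumes E: "E \<in> V" and k: "i + k < cd E"
  shows "functional E (mp_var E ^ i * B E ^ k) = functional E (B E ^ k)"
  unfolding linear_functional_var_power_mult
proof (rule rat_scalar.linear_extension_cong)
  fix m assume m: "m \<in> Poly_Mapping.keys (B E ^ k)"
  have "cnt (Poly_Mapping.single E i + m) F < cd F \<longleftrightarrow> cnt m F < cd F" if "F \<in> V" "F \<subseteq> E" for F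
    using cnt_keys_B_power[OF m, of E] k that E by (cases "F = E") (auto simp: cnt_add cnt_single)
  then show "of_bool (good E (Poly_Mapping.single E i + m)) = (of_bool (good E m) :: rat)"
    by (simp add: good_def)
qed

text \<open>After exchanging the sums, the coefficient of \<open>mp_var u\<close> is minus the sum
  of \<open>mu g u\<close> over nonempty \<open>g\<close> below \<open>u\<close>, which
  \<open>V_sum_mu_left\<close> evaluates.\<close>

lemma substitution_beta: "substitution X (\<Sum>g\<in>V. mp_var g) = B E"
proof -
  have "(\<Sum>g\<in>V. X g) = - (\<Sum>g\<in>V. \<Sum>u\<in>V. mp_const (of_bool (g \<subseteq> u) * mu g u) * mp_var u)"
    unfolding X_def sum_negf
    by (intro arg_cong[of _ _ uminus] sum.cong refl sum.mono_neutral_cong_left)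
      (auto simp: const_scalar.scalar_zero V_iff)
  also have "\<dots> = - (\<Sum>u\<in>V. \<Sum>g\<in>V. mp_const (of_bool (g \<subseteq> u) * mu g u) * mp_var u)"
    by (subst sum.swap) simp
  also have "\<dots> = - (\<Sum>u\<in>V. mp_const (\<Sum>g\<in>V. of_bool (g \<subseteq> u) * mu g u) * mp_var u)"
    by (simp only: sum_distrib_right[symmetric] const_scalar.scalar_sum)
  also have "\<dots> = (\<Sum>u\<in>V. mp_const (mu {} u) * mp_var u)"
    unfolding sum_negf[symmetric]
  proof (rule sum.cong[OF refl])
    fix u assume u: "u \<in> V"
    have "(\<Sum>g\<in>V. of_bool (g \<subseteq> u) * mu g u) = (\<Sum>g\<in>{g \<in> V. g \<subseteq> u}. mu g u)"
      by (intro sum.mono_neutral_cong_right) auto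
    then show "- (mp_const (\<Sum>g\<in>V. of_bool (g \<subseteq> u) * mu g u) * mp_var u) = mp_const (mu {} u) * mp_var u"
      using V_sum_mu_left[OF u] by (simp add: mp_const_def single_uminus)
  qed
  also have "\<dots> = B E"
    unfolding B_def using flat_subset V_iff by (intro sum.cong) blast+
  finally show ?thesis by (simp add: substitution_sum substitution_var)
qed

end

section \<open>The ring \<open>poly_ring W\<close> and weighted degrees\<close>

lemma keys_uminus: "Poly_Mapping.keys (- p) = Poly_Mapping.keys (p :: 'k \<Rightarrow>\<^sub>0 'b::ab_group_add)"
  by (auto simp: in_keys_iff)

lemma poly_ring_simps [simp]:
  "p \<otimes>\<^bsub>poly_ring W\<^esub> q = p * q" "p \<oplus>\<^bsub>poly_ring W\<^esub> q = p + q"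
  "\<one>\<^bsub>poly_ring W\<^esub> = 1" "\<zero>\<^bsub>poly_ring W\<^esub> = 0"
  by (simp_all add: poly_ring_def)

lemma poly_ring_carrier:
  "p \<in> carrier (poly_ring W) \<longleftrightarrow> (\<forall>m\<in>Poly_Mapping.keys p. Poly_Mapping.keys m \<subseteq> W)"
  by (simp add: poly_ring_def)

lemma poly_ring_uminus_closed: "p \<in> carrier (poly_ring W) \<Longrightarrow> - p \<in> carrier (poly_ring W)"
  by (simp add: poly_ring_carrier keys_uminus)

lemma poly_ring_add_closed:
  "p \<in> carrier (poly_ring W) \<Longrightarrow> q \<in> carrier (poly_ring W) \<Longrightarrow> p + q \<in> carrier (poly_ring W)"
  using Poly_Mapping.keys_add[of p q] by (auto simp: poly_ring_carrier)

lemma poly_ring_mult_closed: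
  assumes "p \<in> carrier (poly_ring W)" "q \<in> carrier (poly_ring W)"
  shows "p * q \<in> carrier (poly_ring W)"
  unfolding poly_ring_carrier
proof
  fix m assume "m \<in> Poly_Mapping.keys (p * q)"
  then obtain a b where "m = a + b" "a \<in> Poly_Mapping.keys p" "b \<in> Poly_Mapping.keys q"
    using keys_mult[of p q] by auto
  then show "Poly_Mapping.keys m \<subseteq> W"
    using assms Poly_Mapping.keys_add[of a b] unfolding poly_ring_carrier by blast
qed

lemma poly_ring_const_closed: "mp_const c \<in> carrier (poly_ring W)"
  by (simp add: poly_ring_carrier mp_const_def)

lemma poly_ring_var_closed: "v \<in> W \<Longrightarrow> mp_var v \<in> carrier (poly_ring W)"
  by (simp add: poly_ring_carrier mp_var_def)

lemma poly_ring_cring: "cring (poly_ring W)"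
proof (rule cringI)
  show "abelian_group (poly_ring W)"
    by (rule abelian_groupI)
      (auto intro: poly_ring_add_closed poly_ring_uminus_closed bexI[of _ "- _"]
        simp: add_ac poly_ring_carrier[of 0])
  show "comm_monoid (poly_ring W)"
    using poly_ring_const_closed[of 1 W]
    by unfold_locales (auto intro: poly_ring_mult_closed simp: mult_ac const_scalar.scalar_one)
qed (simp add: ring_distribs)

lemma poly_ring_a_inv: "p \<in> carrier (poly_ring W) \<Longrightarrow> \<ominus>\<^bsub>poly_ring W\<^esub> p = - p"
proof -
  interpret cring "poly_ring W" by (rule poly_ring_cring)
  assume "p \<in> carrier (poly_ring W)"
  then show ?thesis
    using poly_ring_uminus_closed by (intro minus_equality) auto
qed

lemma poly_ring_nat_pow: "p [^]\<^bsub>poly_ring W\<^esub> (n::nat) = p ^ n"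
  by (induction n) (simp_all add: nat_pow_def mult.commute)

lemma poly_ring_power_closed: "p \<in> carrier (poly_ring W) \<Longrightarrow> p ^ n \<in> carrier (poly_ring W)"
  using poly_ring_const_closed[of 1 W]
  by (induction n) (simp_all add: const_scalar.scalar_one poly_ring_mult_closed)

lemma poly_ring_sum_closed:
  "(\<And>i. i \<in> A \<Longrightarrow> p i \<in> carrier (poly_ring W)) \<Longrightarrow> (\<Sum>i\<in>A. p i) \<in> carrier (poly_ring W)"
  by (induction A rule: infinite_finite_induct) (simp_all add: poly_ring_carrier[of 0] poly_ring_add_closed)

lemma poly_ring_prod_closed:
  "(\<And>i. i \<in> A \<Longrightarrow> p i \<in> carrier (poly_ring W)) \<Longrightarrow> (\<Prod>i\<in>A. p i) \<in> carrier (poly_ring W)"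
  using poly_ring_const_closed[of 1 W]
  by (induction A rule: infinite_finite_induct) (simp_all add: const_scalar.scalar_one poly_ring_mult_closed)

lemma poly_ring_finsum:
  assumes "\<And>i. i \<in> A \<Longrightarrow> p i \<in> carrier (poly_ring W)"
  shows "(\<Oplus>\<^bsub>poly_ring W\<^esub> i \<in> A. p i) = (\<Sum>i\<in>A. p i)"
proof -
  interpret cring "poly_ring W" by (rule poly_ring_cring)
  show ?thesis
    using assms
  proof (induction A rule: infinite_finite_induct)
    case (infinite A)
    then show ?case by (simp add: finsum_def finprod_def)
  next
    case (insert a A)
    then show ?case by (subst finsum_insert) auto
  qed simp
qed

text \<open>Unit weights give the ordinary degree; the weights \<open>cd\<close> measure progress
  when monomials are rewritten with larger flats.\<close>

definition weighted_degree :: "('v \<Rightarrow> nat) \<Rightarrow> ('v \<Rightarrow>\<^sub>0 nat) \<Rightarrow> nat" where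
  "weighted_degree c m = (\<Sum>v\<in>Poly_Mapping.keys m. Poly_Mapping.lookup m v * c v)"

lemma weighted_degree_superset:
  assumes "finite K" "Poly_Mapping.keys m \<subseteq> K"
  shows "weighted_degree c m = (\<Sum>v\<in>K. Poly_Mapping.lookup m v * c v)"
  unfolding weighted_degree_def
  by (rule sum.mono_neutral_left[OF assms]) (auto simp: in_keys_iff)

lemma weighted_degree_add: "weighted_degree c (m + m') = weighted_degree c m + weighted_degree c m'"
proof -
  let ?K = "Poly_Mapping.keys m \<union> Poly_Mapping.keys m'"
  have "Poly_Mapping.keys (m + m') \<subseteq> ?K" by (rule Poly_Mapping.keys_add)
  then show ?thesis
    using weighted_degree_superset[of ?K "m + m'" c] weighted_degree_superset[of ?K m c]
      weighted_degree_superset[of ?K m' c]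
    by (simp add: lookup_add ring_distribs sum.distrib)
qed

lemma weighted_degree_single [simp]: "weighted_degree c (Poly_Mapping.single v k) = k * c v"
  by (simp add: weighted_degree_def)

lemma monomial_degree_weighted: "monomial_degree m = weighted_degree (\<lambda>_. 1) m"
  by (simp add: monomial_degree_def weighted_degree_def)

section \<open>The top degree part of the Chow ring\<close>

context loopless_polymatroid
begin

text \<open>The lower bound \<open>w\<close> on the \<open>cd\<close>-weight filters the homogeneous
  polynomials; \<open>w = 0\<close> is plain homogeneity.\<close>

definition graded :: "nat \<Rightarrow> nat \<Rightarrow> 'a set rat_mpoly \<Rightarrow> bool" where
  "graded d w p \<longleftrightarrow> (\<forall>m\<in>Poly_Mapping.keys p. Poly_Mapping.keys m \<subseteq> V \<and>
    monomial_degree m = d \<and> w \<le> weighted_degree cd m)"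

lemma graded_zero [simp]: "graded d w 0"
  by (simp add: graded_def)

lemma graded_mono: "graded d w p \<Longrightarrow> w' \<le> w \<Longrightarrow> graded d w' p"
  by (auto simp: graded_def)

lemma graded_add: "graded d w p \<Longrightarrow> graded d w q \<Longrightarrow> graded d w (p + q)"
  using Poly_Mapping.keys_add[of p q] by (auto simp: graded_def)

lemma graded_uminus: "graded d w p \<Longrightarrow> graded d w (- p)"
  by (simp add: graded_def keys_uminus)

lemma graded_sum: "(\<And>i. i \<in> A \<Longrightarrow> graded d w (p i)) \<Longrightarrow> graded d w (\<Sum>i\<in>A. p i)"
  by (induction A rule: infinite_finite_induct) (simp_all add: graded_add)

lemma graded_mult:
  assumes "graded d w p" "graded d' w' q"
  shows "graded (d + d') (w + w') (p * q)"
  unfolding graded_def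
proof
  fix m assume "m \<in> Poly_Mapping.keys (p * q)"
  then obtain a b where m: "m = a + b" "a \<in> Poly_Mapping.keys p" "b \<in> Poly_Mapping.keys q"
    using keys_mult[of p q] by auto
  moreover have "Poly_Mapping.keys (a + b) \<subseteq> Poly_Mapping.keys a \<union> Poly_Mapping.keys b"
    by (rule Poly_Mapping.keys_add)
  ultimately show "Poly_Mapping.keys m \<subseteq> V \<and> monomial_degree m = d + d' \<and> w + w' \<le> weighted_degree cd m"
    using assms by (auto simp: graded_def monomial_degree_weighted weighted_degree_add add_mono)
qed

lemma graded_single:
  "Poly_Mapping.keys m \<subseteq> V \<Longrightarrow> graded (monomial_degree m) (weighted_degree cd m) (Poly_Mapping.single m c)"
  by (simp add: graded_def)

lemma graded_var: "v \<in> V \<Longrightarrow> graded 1 (cd v) (mp_var v)"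
  by (simp add: graded_def mp_var_def monomial_degree_weighted)

lemma graded_one: "graded 0 0 1"
  using graded_single[of 0 1] by (simp add: monomial_degree_weighted weighted_degree_def)

lemma graded_power: "graded d w p \<Longrightarrow> graded (n * d) (n * w) (p ^ n)"
  by (induction n) (simp_all add: graded_one graded_mult)

lemma graded_carrier: "graded d w p \<Longrightarrow> p \<in> carrier (poly_ring V)"
  by (simp add: graded_def poly_ring_carrier)

lemma homogeneous_iff_graded: "p \<in> homogeneous_polys V d \<longleftrightarrow> graded d 0 p"
  by (auto simp: homogeneous_polys_def graded_def poly_ring_carrier)

text \<open>Used with \<open>x\<close> a generator and \<open>y\<close> the sum of the generators of
  strictly larger flats: all terms of the expanded power except the leading one gain weight.\<close>

lemma graded_power_diff:
  assumes x: "graded 1 w x" and y: "graded 1 (w + 1) y"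
  shows "graded b (b * w + 1) ((x + y) ^ b - x ^ b)"
proof (induction b)
  case (Suc b)
  have xy: "graded 1 w (x + y)" using x graded_mono[OF y] by (intro graded_add) auto
  have "(x + y) ^ Suc b - x ^ Suc b = (x + y) * ((x + y) ^ b - x ^ b) + y * x ^ b"
    by (simp add: algebra_simps)
  moreover have "graded (Suc b) (Suc b * w + 1) ((x + y) * ((x + y) ^ b - x ^ b))"
    using graded_mult[OF xy Suc.IH] by (simp add: add_ac)
  moreover have "graded (Suc b) (Suc b * w + 1) (y * x ^ b)"
    using graded_mult[OF y graded_power[OF x, of b]] by (simp add: add_ac)
  ultimately show ?case by (simp only: graded_add)
qed simp

section \<open>The defining ideal and the functional on it\<close>

abbreviation I where "I \<equiv> chow_ideal E cd"

lemma chow_relations_carrier: "chow_relations E cd \<subseteq> carrier (poly_ring V)"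
  unfolding chow_relations_def
  by (auto intro!: poly_ring_mult_closed poly_ring_prod_closed poly_ring_power_closed
      poly_ring_sum_closed poly_ring_var_closed)

lemma chow_ideal_ideal: "ideal I (poly_ring V)"
proof -
  interpret cring "poly_ring V" by (rule poly_ring_cring)
  show ?thesis unfolding chow_ideal_def by (rule genideal_ideal[OF chow_relations_carrier])
qed

lemma ideal_add: "p \<in> I \<Longrightarrow> q \<in> I \<Longrightarrow> p + q \<in> I"
  using additive_subgroup.a_closed[OF ideal.axioms(1)[OF chow_ideal_ideal], of p q] by simp

lemma ideal_mult: "p \<in> I \<Longrightarrow> q \<in> carrier (poly_ring V) \<Longrightarrow> p * q \<in> I"
  using ideal.I_r_closed[OF chow_ideal_ideal, of p q] by simp

lemma ideal_zero: "0 \<in> I"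
  using additive_subgroup.zero_closed[OF ideal.axioms(1)[OF chow_ideal_ideal]] by simp

lemma ideal_relation:
  assumes "S \<subseteq> V" "g \<in> V" "cd g \<le> b + cd (\<Squnion>\<^bsub>flat_lattice E cd\<^esub> {s \<in> S. s \<subset> g})"
    and "q \<in> carrier (poly_ring V)"
  shows "(\<Prod>s\<in>S. mp_var s) * (\<Sum>h\<in>{h \<in> V. g \<subseteq> h}. mp_var h) ^ b * q \<in> I"
proof -
  interpret cring "poly_ring V" by (rule poly_ring_cring)
  have "(\<Prod>s\<in>S. mp_var s) * (\<Sum>h\<in>{h \<in> V. g \<subseteq> h}. mp_var h) ^ b \<in> chow_relations E cd"
    using assms unfolding chow_relations_def by blast
  then have "(\<Prod>s\<in>S. mp_var s) * (\<Sum>h\<in>{h \<in> V. g \<subseteq> h}. mp_var h) ^ b \<in> I"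
    using genideal_self[OF chow_relations_carrier] by (auto simp: chow_ideal_def)
  then show ?thesis using assms(4) by (rule ideal_mult)
qed

text \<open>The polynomials all of whose multiples are killed form an ideal, so it is enough that
  the relations are among them; the extra factor \<open>q\<close> in
  \<open>chow_functional_relation\<close> provides this.\<close>

lemma chow_functional_ideal:
  assumes "p \<in> I"
  shows "chow_functional p = 0"
proof -
  interpret cring "poly_ring V" by (rule poly_ring_cring)
  let ?K = "{p \<in> carrier (poly_ring V). \<forall>q. chow_functional (p * q) = 0}"
  have add: "chow_functional (a + b) = chow_functional a + chow_functional b" for a b
    by (simp add: chow_functional_def substitution_add rat_scalar.linear_extension_add)
  have uminus: "chow_functional (- a) = - chow_functional a" for a
    by (simp add: chow_functional_def substitution_uminus rat_scalar.linear_extension_uminus)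
  have zero: "chow_functional 0 = 0" using add[of 0 0] by simp
  have "ideal ?K (poly_ring V)"
  proof (rule idealI[OF ring_axioms])
    show "subgroup ?K (add_monoid (poly_ring V))"
    proof (rule add.subgroupI)
      show "?K \<noteq> {}" using zero by (auto simp: poly_ring_carrier intro!: exI[of _ 0])
    next
      fix a assume "a \<in> ?K"
      then show "\<ominus>\<^bsub>poly_ring V\<^esub> a \<in> ?K"
        by (simp add: poly_ring_a_inv poly_ring_uminus_closed uminus)
    qed (auto simp: poly_ring_add_closed ring_distribs add)
  next
    fix a x assume a: "a \<in> ?K" and x: "x \<in> carrier (poly_ring V)"
    have "chow_functional (a * (x * q)) = 0" for q using a by blast
    then show "a \<otimes>\<^bsub>poly_ring V\<^esub> x \<in> ?K" "x \<otimes>\<^bsub>poly_ring V\<^esub> a \<in> ?K"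
      using a x by (simp_all add: poly_ring_mult_closed mult_ac)
  qed
  moreover have "chow_relations E cd \<subseteq> ?K"
    using chow_relations_carrier chow_functional_relation
    unfolding chow_relations_def by blast
  ultimately have "I \<subseteq> ?K"
    unfolding chow_ideal_def by (rule genideal_minimal)
  then have "chow_functional (p * 1) = 0" using assms by blast
  then show ?thesis by simp
qed

section \<open>Spanning of the top degree part\<close>

text \<open>The monomial is divisible by the product over \<open>S\<close> times the
  \<open>b\<close>-th power of \<open>g\<close>. The relation for \<open>S\<close>, \<open>g\<close>
  and \<open>b\<close> has this product as its leading term, and its other terms have the same
  degree but larger \<open>cd\<close>-weight.\<close>

lemma monomial_reduction:
  assumes m: "Poly_Mapping.keys m \<subseteq> V" and S: "S \<subseteq> Poly_Mapping.keys m" and g: "g \<in> V" "g \<notin> S"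
    and b: "b \<le> Poly_Mapping.lookup m g" "cd g \<le> b + cd (\<Squnion>\<^bsub>flat_lattice E cd\<^esub> {s \<in> S. s \<subset> g})"
  shows "\<exists>q. graded (monomial_degree m) (weighted_degree cd m + 1) q \<and> Poly_Mapping.single m 1 - q \<in> I"
proof -
  have fin: "finite S" using S finite_subset finite_keys by blast
  define a where "a = (\<Sum>s\<in>S. Poly_Mapping.single s (1::nat))"
  have a: "Poly_Mapping.lookup a v = of_bool (v \<in> S)" for v
    using fin by (simp add: a_def lookup_sum lookup_single when_def of_bool_def sum.delta)
  define n where "n = m - (a + Poly_Mapping.single g b)"
  have le: "Poly_Mapping.lookup (a + Poly_Mapping.single g b) v \<le> Poly_Mapping.lookup m v" for v
    using S g b by (auto simp: lookup_add a lookup_single when_def in_keys_iff Suc_le_eq)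
  have split: "m = a + Poly_Mapping.single g b + n"
  proof (rule poly_mapping_eqI)
    fix v show "Poly_Mapping.lookup m v = Poly_Mapping.lookup (a + Poly_Mapping.single g b + n) v"
      using le[of v] by (simp add: n_def lookup_add[of _ "_ - _"] lookup_minus)
  qed
  have "Poly_Mapping.keys n \<subseteq> Poly_Mapping.keys m"
    by (auto simp: n_def in_keys_iff lookup_minus)
  then have nV: "Poly_Mapping.keys n \<subseteq> V" using m by blast
  have aV: "Poly_Mapping.keys a \<subseteq> V" using S m by (auto simp: in_keys_iff a)
  have prod_a: "(\<Prod>s\<in>S. mp_var s) = Poly_Mapping.single a 1"
    unfolding a_def using fin by (induction S) (simp_all add: mp_var_def mult_single)
  let ?N = "Poly_Mapping.single n (1::rat)" and ?A = "Poly_Mapping.single a (1::rat)"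
  define Y where "Y = (\<Sum>h\<in>{h \<in> V. g \<subset> h}. mp_var h :: 'a set rat_mpoly)"
  have "{h \<in> V. g \<subseteq> h} = insert g {h \<in> V. g \<subset> h}" using g by auto
  then have up: "(\<Sum>h\<in>{h \<in> V. g \<subseteq> h}. mp_var h) = mp_var g + Y" by (simp add: Y_def)
  have "graded 1 (cd g + 1) Y"
    unfolding Y_def using flat_cd_strict[of g] g
    by (intro graded_sum graded_mono[OF graded_var]) (auto simp: V_iff Suc_le_eq)
  then have diff: "graded b (b * cd g + 1) ((mp_var g + Y) ^ b - mp_var g ^ b)"
    using graded_power_diff[OF graded_var[OF g(1)]] by blast
  define q where "q = ?A * (- ((mp_var g + Y) ^ b - mp_var g ^ b)) * ?N"
  have "graded (monomial_degree a + b + monomial_degree n)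
      (weighted_degree cd a + (b * cd g + 1) + weighted_degree cd n) q"
    unfolding q_def by (intro graded_mult graded_single graded_uminus diff aV nV)
  moreover have "monomial_degree m = monomial_degree a + b + monomial_degree n"
    "weighted_degree cd m = weighted_degree cd a + b * cd g + weighted_degree cd n"
    by (simp_all add: split monomial_degree_weighted weighted_degree_add)
  ultimately have "graded (monomial_degree m) (weighted_degree cd m + 1) q" by simp
  moreover have "Poly_Mapping.single m 1 = ?A * mp_var g ^ b * ?N"
    by (simp add: mp_var_power mult_single split)
  then have "Poly_Mapping.single m 1 - q = ?A * (mp_var g + Y) ^ b * ?N"
    by (simp add: q_def algebra_simps)
  moreover have "\<dots> \<in> I"
    using ideal_relation[of S g b ?N] S m g b(2) nV
    by (simp add: up prod_a poly_ring_carrier)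
  ultimately show ?thesis by auto
qed

text \<open>Pigeonhole: if no exponent along a chain is large enough for a relation to apply, the total
  degree is less than \<open>cd\<close> of the largest element, with equality only for a single generator.\<close>

lemma chain_exponent_bound:
  assumes K: "finite K" "K \<subseteq> V" and chain: "\<And>s t. s \<in> K \<Longrightarrow> t \<in> K \<Longrightarrow> s \<subseteq> t \<or> t \<subseteq> s"
    and small: "\<And>g. g \<in> K \<Longrightarrow> e g + cd (\<Squnion>\<^bsub>flat_lattice E cd\<^esub> {s \<in> K. s \<subset> g}) < cd g"
    and g: "g \<in> K"
  shows "(\<Sum>v\<in>{v \<in> K. v \<subseteq> g}. e v) + 1 + of_bool (\<exists>s\<in>K. s \<subset> g) \<le> cd g"
  using g
proof (induction "cd g" arbitrary: g rule: less_induct)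
  case less
  let ?S = "{s \<in> K. s \<subset> g}"
  have split: "{v \<in> K. v \<subseteq> g} = insert g ?S" using less.prems by auto
  then have sum: "(\<Sum>v\<in>{v \<in> K. v \<subseteq> g}. e v) = e g + (\<Sum>v\<in>?S. e v)" using K by simp
  show ?case
  proof (cases "?S = {}")
    case True
    then have "\<not> (\<exists>s\<in>K. s \<subset> g)" by blast
    moreover have "e g < cd g" using small[OF less.prems] unfolding True by linarith
    ultimately show ?thesis using sum unfolding True by simp
  next
    case False
    have "finite ?S" using K by simp
    from finite_has_maximal[OF this False]
    obtain p where p: "p \<in> ?S" and "\<forall>t\<in>?S. p \<subseteq> t \<longrightarrow> p = t" ..
    then have max: "\<forall>t\<in>?S. t \<subseteq> p" using chain by blast
    then have "\<Squnion>\<^bsub>flat_lattice E cd\<^esub> ?S = p"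
      using p K by (intro sup_flats_greatest) (auto simp: V_iff)
    then have "e g + cd p < cd g" using small[OF less.prems] by simp
    moreover have "?S = {v \<in> K. v \<subseteq> p}" using max p by auto
    then have "(\<Sum>v\<in>?S. e v) = (\<Sum>v\<in>{v \<in> K. v \<subseteq> p}. e v)" by (simp only:)
    moreover have "(\<Sum>v\<in>{v \<in> K. v \<subseteq> p}. e v) + 1 + of_bool (\<exists>s\<in>K. s \<subset> p) \<le> cd p"
    proof (rule less.hyps)
      show "cd p < cd g" using p less.prems K by (intro flat_cd_strict) (auto simp: V_iff)
    qed (use p in blast)
    moreover have "of_bool (\<exists>s\<in>K. s \<subset> g) \<le> (1::nat)" by simp
    ultimately show ?thesis using sum by linarith
  qed
qed

lemma top_monomial_reduction:
  assumes m: "Poly_Mapping.keys m \<subseteq> V" "monomial_degree m + 1 = cd E"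
    and ne: "m \<noteq> Poly_Mapping.single E (cd E - 1)"
  shows "\<exists>q. graded (monomial_degree m) (weighted_degree cd m + 1) q \<and> Poly_Mapping.single m 1 - q \<in> I"
proof (cases "\<exists>s\<in>Poly_Mapping.keys m. \<exists>t\<in>Poly_Mapping.keys m. \<not> s \<subseteq> t \<and> \<not> t \<subseteq> s")
  case True
  then obtain s t where st: "s \<in> Poly_Mapping.keys m" "t \<in> Poly_Mapping.keys m" "\<not> s \<subseteq> t" "\<not> t \<subseteq> s"
    by blast
  have fl: "s \<in> FL" "t \<in> FL" "s \<noteq> {}" using st m by (auto simp: V_iff)
  \<comment> \<open>At the join of two incomparable flats the relation holds with exponent 0, so the
    product of the two generators already lies in the ideal.\<close>
  let ?g = "cl (s \<union> t)"
  have g: "?g \<in> FL" "s \<subset> ?g" "t \<subset> ?g"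
    using join_flat[OF fl(1,2)] join_upper[OF fl(1,2)] st by auto
  then have below: "{u \<in> {s, t}. u \<subset> ?g} = {s, t}" by auto
  have "s \<subseteq> F \<and> t \<subseteq> F \<longleftrightarrow> ?g \<subseteq> F" if "F \<in> FL" for F
    using join_iff[of s t F] fl flat_subset that by simp
  then have "\<Squnion>\<^bsub>flat_lattice E cd\<^esub> {s, t} = ?g"
    using g fl by (intro sup_flats_eq) auto
  then have "cd ?g \<le> 0 + cd (\<Squnion>\<^bsub>flat_lattice E cd\<^esub> {u \<in> {s, t}. u \<subset> ?g})"
    unfolding below by simp
  moreover have "?g \<in> V" "?g \<notin> {s, t}" using g fl by (auto simp: V_iff)
  ultimately show ?thesis using st m by (intro monomial_reduction[of m "{s, t}" ?g 0]) auto
next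
  case False
  then have chain: "s \<subseteq> t \<or> t \<subseteq> s" if "s \<in> Poly_Mapping.keys m" "t \<in> Poly_Mapping.keys m" for s t
    using that by blast
  let ?K = "Poly_Mapping.keys m" and ?e = "Poly_Mapping.lookup m"
  \<comment> \<open>If no relation applied, \<open>chain_exponent_bound\<close> at the largest flat
    of the support would leave only the excluded power of \<open>mp_var E\<close>.\<close>
  have "\<exists>g\<in>?K. cd g \<le> ?e g + cd (\<Squnion>\<^bsub>flat_lattice E cd\<^esub> {s \<in> ?K. s \<subset> g})"
  proof (rule ccontr)
    assume "\<not> ?thesis"
    then have small: "?e g + cd (\<Squnion>\<^bsub>flat_lattice E cd\<^esub> {s \<in> ?K. s \<subset> g}) < cd g" if "g \<in> ?K" for g
      using that by force
    have deg: "(\<Sum>v\<in>?K. ?e v) = cd E - 1"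
      using m(2) by (simp add: monomial_degree_def)
    \<comment> \<open>Empty support means \<open>m = 0\<close> and \<open>cd E = 1\<close>, and then
      \<open>m\<close> is the excluded power with exponent 0.\<close>
    have "?K \<noteq> {}"
    proof
      assume "?K = {}"
      then have "m = 0" "cd E - 1 = 0"
        using deg by (auto intro!: poly_mapping_eqI simp: in_keys_iff)
      then show False using ne by simp
    qed
    then obtain g where g: "g \<in> ?K" and "\<forall>t\<in>?K. g \<subseteq> t \<longrightarrow> g = t"
      using finite_has_maximal[of ?K] by auto
    then have g_max: "\<forall>t\<in>?K. t \<subseteq> g" using chain by blast
    then have "{v \<in> ?K. v \<subseteq> g} = ?K" by auto
    \<comment> \<open>The left side is at least \<open>cd E\<close> and the right side at most
      \<open>cd E\<close>. Equality forces both \<open>g = E\<close> and the absence of smaller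
      flats in the support.\<close>
    then have bound: "cd E - 1 + 1 + of_bool (\<exists>s\<in>?K. s \<subset> g) \<le> cd g"
      using chain_exponent_bound[OF finite_keys m(1) chain small g] deg by simp
    have gF: "g \<in> FL" using g m by (auto simp: V_iff)
    have le: "cd g \<le> cd E" using flat_subset[OF gF] by (intro cd_mono) auto
    then have "g = E"
      using bound flat_cd_strict[OF gF ground_flat] flat_subset[OF gF] m(2) by fastforce
    moreover have "\<not> (\<exists>s\<in>?K. s \<subset> g)" using bound le m(2) by (cases "\<exists>s\<in>?K. s \<subset> g") auto
    then have "?K = {g}" using g g_max by blast
    ultimately have K: "?K = {E}" by simp
    then have "m = Poly_Mapping.single E (?e E)"
      by (intro poly_mapping_eqI) (auto simp: lookup_single when_def in_keys_iff)
    moreover have "?e E = cd E - 1" using deg unfolding K by simp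
    ultimately show False using ne by simp
  qed
  then obtain g where g: "g \<in> ?K" and le: "cd g \<le> ?e g + cd (\<Squnion>\<^bsub>flat_lattice E cd\<^esub> {s \<in> ?K. s \<subset> g})"
    by blast
  have "{u \<in> {s \<in> ?K. s \<subset> g}. u \<subset> g} = {s \<in> ?K. s \<subset> g}" by auto
  then show ?thesis using g le m by (intro monomial_reduction[of m "{s \<in> ?K. s \<subset> g}" g "?e g"]) auto
qed

lemma ideal_sum: "(\<And>i. i \<in> A \<Longrightarrow> p i \<in> I) \<Longrightarrow> (\<Sum>i\<in>A. p i) \<in> I"
  by (induction A rule: infinite_finite_induct) (simp_all add: ideal_zero ideal_add)

lemma weighted_degree_le:
  assumes "Poly_Mapping.keys m \<subseteq> V"
  shows "weighted_degree cd m \<le> monomial_degree m * cd E"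
  unfolding weighted_degree_def monomial_degree_def sum_distrib_right
  using assms flat_cd_mono[OF ground_flat] flat_subset
  by (intro sum_mono mult_left_mono) (auto simp: V_iff subset_iff)

text \<open>The number \<open>n\<close> measures how far \<open>w\<close> is from exceeding
  \<open>r * cd E\<close>, the largest possible weight in degree \<open>r\<close>. Every monomial
  other than the power of \<open>mp_var E\<close> is congruent to a heavier polynomial, and for
  \<open>n = 0\<close> no monomial is left.\<close>

lemma top_degree_span_aux:
  assumes "graded r w p" "r + 1 = cd E" "w + n = r * cd E + 1"
  shows "\<exists>c. p - mp_const c * mp_var E ^ r \<in> I"
  using assms
proof (induction n arbitrary: p w)
  case 0
  have "Poly_Mapping.keys p = {}"
  proof (rule equals0I)
    fix m assume "m \<in> Poly_Mapping.keys p"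
    then have "Poly_Mapping.keys m \<subseteq> V" "monomial_degree m = r" "w \<le> weighted_degree cd m"
      using 0 by (auto simp: graded_def)
    then show False using weighted_degree_le[of m] 0 by simp
  qed
  then have "p = 0" by (simp add: poly_mapping_eqI in_keys_iff)
  then show ?case using ideal_zero by (auto intro!: exI[of _ 0] simp: const_scalar.scalar_zero)
next
  case (Suc n)
  let ?x = "mp_var E ^ r :: 'a set rat_mpoly"
  have "\<exists>c. Poly_Mapping.single m 1 - mp_const c * ?x \<in> I" if "m \<in> Poly_Mapping.keys p" for m
  proof (cases "m = Poly_Mapping.single E r")
    case True
    then show ?thesis
      using ideal_zero by (auto intro!: exI[of _ 1] simp: const_scalar.scalar_one mp_var_power)
  next
    case False
    have m: "Poly_Mapping.keys m \<subseteq> V" "monomial_degree m = r" "w \<le> weighted_degree cd m"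
      using that Suc.prems by (auto simp: graded_def)
    have "r = cd E - 1" using Suc.prems by simp
    then obtain q where q: "graded r (weighted_degree cd m + 1) q" "Poly_Mapping.single m 1 - q \<in> I"
      using top_monomial_reduction[OF m(1)] m(2) False Suc.prems by auto
    have "graded r (w + 1) q" using q(1) m(3) by (auto intro: graded_mono)
    then obtain c where c: "q - mp_const c * ?x \<in> I" using Suc.IH[of "w + 1" q] Suc.prems by auto
    have "Poly_Mapping.single m 1 - mp_const c * ?x \<in> I"
      using ideal_add[OF q(2) c] by simp
    then show ?thesis ..
  qed
  then obtain c where c: "\<And>m. m \<in> Poly_Mapping.keys p \<Longrightarrow> Poly_Mapping.single m 1 - mp_const (c m) * ?x \<in> I"
    by metis
  let ?a = "Poly_Mapping.lookup p"
  have "p = (\<Sum>m\<in>Poly_Mapping.keys p. mp_const (?a m) * Poly_Mapping.single m 1)"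
    by (subst poly_mapping_sum_single[of p]) (simp add: mp_const_def mult_single)
  moreover have "mp_const (\<Sum>m\<in>Poly_Mapping.keys p. ?a m * c m) * ?x =
      (\<Sum>m\<in>Poly_Mapping.keys p. mp_const (?a m) * (mp_const (c m) * ?x))"
    by (simp add: const_scalar.scalar_sum[symmetric] sum_distrib_right const_scalar.scalar_mult mult.assoc)
  ultimately have "p - mp_const (\<Sum>m\<in>Poly_Mapping.keys p. ?a m * c m) * ?x =
      (\<Sum>m\<in>Poly_Mapping.keys p. (Poly_Mapping.single m 1 - mp_const (c m) * ?x) * mp_const (?a m))"
    by (simp add: algebra_simps sum_subtractf)
  also have "\<dots> \<in> I"
    using c poly_ring_const_closed by (intro ideal_sum ideal_mult) auto
  finally show ?case ..
qed

lemma top_degree_span: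
  assumes "p \<in> homogeneous_polys V r" "r + 1 = cd E"
  obtains c where "p - mp_const c * mp_var E ^ r \<in> I"
  using top_degree_span_aux[of r 0 p "r * cd E + 1"] assms by (auto simp: homogeneous_iff_graded)

section \<open>Passage to residue classes\<close>

lemma chow_class_hom: "ring_hom_cring (poly_ring V) (chow_ring E cd) (chow_class E cd)"
proof -
  have "chow_class E cd = (+>\<^bsub>poly_ring V\<^esub>) I" by (rule ext) (simp add: chow_class_def)
  then show ?thesis
    using ideal.rcos_ring_hom_cring[OF chow_ideal_ideal poly_ring_cring] by (simp add: chow_ring_def)
qed

lemma chow_class_eq_iff:
  assumes "p \<in> carrier (poly_ring V)" "q \<in> carrier (poly_ring V)"
  shows "chow_class E cd p = chow_class E cd q \<longleftrightarrow> p - q \<in> I"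
proof -
  interpret cring "poly_ring V" by (rule poly_ring_cring)
  show ?thesis
    using quotient_eq_iff_same_a_r_cos[OF chow_ideal_ideal assms] assms
    by (simp add: chow_class_def a_minus_def poly_ring_a_inv)
qed

lemma chow_class_mult:
  "p \<in> carrier (poly_ring V) \<Longrightarrow> q \<in> carrier (poly_ring V) \<Longrightarrow>
    chow_class E cd p \<otimes>\<^bsub>chow_ring E cd\<^esub> chow_class E cd q = chow_class E cd (p * q)"
  using ring_hom_mult[OF ring_hom_cring.homh[OF chow_class_hom], of p q] by simp

lemma chow_class_add:
  "p \<in> carrier (poly_ring V) \<Longrightarrow> q \<in> carrier (poly_ring V) \<Longrightarrow>
    chow_class E cd p \<oplus>\<^bsub>chow_ring E cd\<^esub> chow_class E cd q = chow_class E cd (p + q)"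
  using ring_hom_add[OF ring_hom_cring.homh[OF chow_class_hom], of p q] by simp

lemma chow_class_uminus:
  "p \<in> carrier (poly_ring V) \<Longrightarrow> \<ominus>\<^bsub>chow_ring E cd\<^esub> chow_class E cd p = chow_class E cd (- p)"
  using ring_hom_cring.hom_a_inv[OF chow_class_hom, of p] by (simp add: poly_ring_a_inv)

lemma chow_class_power:
  assumes "p \<in> carrier (poly_ring V)"
  shows "chow_class E cd p [^]\<^bsub>chow_ring E cd\<^esub> (n::nat) = chow_class E cd (p ^ n)"
proof -
  have "chow_class E cd = (+>\<^bsub>poly_ring V\<^esub>) I" by (rule ext) (simp add: chow_class_def)
  then show ?thesis
    using ring_hom_ring.hom_nat_pow[OF ideal.rcos_ring_hom_ring[OF chow_ideal_ideal] assms, of n]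
    by (simp add: chow_ring_def poly_ring_nat_pow)
qed

lemma chow_alpha_class:
  assumes "E \<in> V"
  shows "chow_alpha E cd = chow_class E cd (- mp_var E)"
  unfolding chow_alpha_def chow_gen_def top_flats
  by (rule chow_class_uminus[OF poly_ring_var_closed[OF assms]])

lemma chow_beta_class: "chow_beta E cd = chow_class E cd (\<Sum>g\<in>V. mp_var g)"
proof -
  have "mp_var \<in> V \<rightarrow> carrier (poly_ring V)" by (auto intro: poly_ring_var_closed)
  from ring_hom_cring.hom_finsum[OF chow_class_hom this]
  have "chow_class E cd (\<Oplus>\<^bsub>poly_ring V\<^esub> g \<in> V. mp_var g) = chow_beta E cd"
    by (simp add: chow_beta_def chow_gen_def[abs_def] comp_def)
  then show ?thesis by (simp add: poly_ring_finsum poly_ring_var_closed)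
qed

section \<open>Identification of the functional with the degree map\<close>

lemma chow_functional_add: "chow_functional (p + q) = chow_functional p + chow_functional q"
  by (simp add: chow_functional_def substitution_add rat_scalar.linear_extension_add)

lemma chow_functional_scale: "chow_functional (mp_const c * p) = c * chow_functional p"
  by (simp add: chow_functional_def substitution_mult substitution_const linear_functional_const_mult)

lemma chow_functional_cong:
  assumes "p - q \<in> I"
  shows "chow_functional p = chow_functional q"
  using chow_functional_ideal[OF assms] chow_functional_add[of "p - q" q] by simp

lemma chow_functional_alpha_beta:
  assumes E: "E \<in> V" and k: "i + k < cd E"
  shows "chow_functional ((- mp_var E) ^ i * (\<Sum>g\<in>V. mp_var g) ^ k) =
    (-1) ^ k * (\<Sum>g\<in>{g \<in> FL. cd g \<le> k}. mu {} g)"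
proof -
  \<comment> \<open>Since \<open>E\<close> is the only flat above \<open>E\<close>, the substitution
    sends \<alpha> to the plain variable \<open>mp_var E\<close>.\<close>
  have "{u \<in> FL. E \<subseteq> u} = {E}" using flat_subset ground_flat by auto
  then have "X E = - mp_var E"
    by (simp add: X_def mu_refl[OF ground_flat] const_scalar.scalar_one)
  then have "chow_functional ((- mp_var E) ^ i * (\<Sum>g\<in>V. mp_var g) ^ k) =
      functional E (mp_var E ^ i * B E ^ k)"
    by (simp add: chow_functional_def substitution_mult substitution_power substitution_uminus
        substitution_var substitution_beta)
  also have "{g \<in> FL. g \<subseteq> E \<and> cd g \<le> k} = {g \<in> FL. cd g \<le> k}" using flat_subset by auto
  then have "functional E (mp_var E ^ i * B E ^ k) = (-1) ^ k * (\<Sum>g\<in>{g \<in> FL. cd g \<le> k}. mu {} g)"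
    by (simp add: functional_ground_power_mult[OF E k] functional_B_power[OF E])
  finally show ?thesis .
qed

lemma chow_functional_top:
  assumes E: "E \<in> V" and r: "r + 1 = cd E"
  shows "chow_functional (mp_var E ^ r) = (-1) ^ r"
proof -
  have "g \<in> FL \<and> cd g \<le> 0 \<longleftrightarrow> g = {}" for g
    using cd_V_pos[of g] empty_flat V_iff[of g] cd_empty by fastforce
  then have "{g \<in> FL. cd g \<le> 0} = {{}}" by simp
  then have "chow_functional ((- mp_var E) ^ r) = 1"
    using chow_functional_alpha_beta[OF E, of r 0] r by (simp add: mu_refl[OF empty_flat])
  moreover have "mp_var E ^ r = mp_const ((-1) ^ r) * (- mp_var E) ^ r"
  proof -
    have "mp_const ((-1) ^ r) = ((-1) ^ r :: 'a set rat_mpoly)"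
      by (induction r) (simp_all add: mp_const_def single_uminus mult_single[of 0 _ 0, simplified, symmetric])
    then show ?thesis by (simp add: power_mult_distrib[symmetric])
  qed
  ultimately show ?thesis by (simp add: chow_functional_scale)
qed

lemma chow_graded_partE:
  assumes "x \<in> chow_graded_part E cd r" "r + 1 = cd E" and E: "E \<in> V"
  obtains c where "x = chow_class E cd (mp_const c * mp_var E ^ r)"
    "x = chow_scale E cd c (chow_class E cd (mp_var E ^ r))"
proof -
  from assms obtain p where p: "p \<in> homogeneous_polys V r" "x = chow_class E cd p"
    by (auto simp: chow_graded_part_def)
  then obtain c where c: "p - mp_const c * mp_var E ^ r \<in> I" using top_degree_span assms by metis
  have carr: "p \<in> carrier (poly_ring V)" "mp_var E ^ r \<in> carrier (poly_ring V)"
    using p E by (auto simp: homogeneous_polys_def poly_ring_power_closed poly_ring_var_closed)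
  then have "x = chow_class E cd (mp_const c * mp_var E ^ r)"
    using c p by (simp add: chow_class_eq_iff poly_ring_mult_closed poly_ring_const_closed)
  moreover from this have "x = chow_scale E cd c (chow_class E cd (mp_var E ^ r))"
    using carr by (simp add: chow_scale_def chow_class_mult poly_ring_const_closed)
  ultimately show ?thesis using that by blast
qed

text \<open>Existence and uniqueness of the degree map both rest on the top degree part consisting
  of the multiples of the class of \<open>mp_var E ^ r\<close>, on which the functional has the
  prescribed nonzero value.\<close>

lemma chow_degree_eq:
  assumes r: "r + 1 = cd E" and E: "E \<in> V" and p: "p \<in> homogeneous_polys V r"
  shows "chow_degree E cd (chow_class E cd p) = chow_functional p"
proof -
  let ?D = "chow_graded_part E cd r" and ?C = "carrier (poly_ring V)"
  let ?top = "mp_var E ^ r :: 'a set rat_mpoly"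
  \<comment> \<open>The choice of representative does not matter because the functional vanishes on
    the ideal; restricting to \<open>?D\<close> gives the required extensionality.\<close>
  define f where "f = (\<lambda>x\<in>?D. chow_functional (SOME p. p \<in> ?C \<and> chow_class E cd p = x))"
  have r': "pm_top_degree E cd = r" using r by (simp add: pm_top_degree_def)
  have f: "f (chow_class E cd p) = chow_functional p" if "p \<in> ?C" "chow_class E cd p \<in> ?D" for p
  proof -
    let ?q = "SOME q. q \<in> ?C \<and> chow_class E cd q = chow_class E cd p"
    have "?q \<in> ?C \<and> chow_class E cd ?q = chow_class E cd p"
      using that by (intro someI) auto
    then have "chow_functional ?q = chow_functional p"
      using that by (intro chow_functional_cong) (simp add: chow_class_eq_iff[symmetric])
    then show ?thesis using that by (simp add: f_def)
  qed
  have top: "?top \<in> ?C" using E by (intro poly_ring_power_closed poly_ring_var_closed)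
  have DE: "\<exists>c. x = chow_class E cd (mp_const c * ?top)" if "x \<in> ?D" for x
    using chow_graded_partE[OF that r E] by metis
  have mult: "mp_const c * ?top \<in> ?C" for c
    using top by (intro poly_ring_mult_closed poly_ring_const_closed)
  have D: "chow_class E cd (mp_const c * ?top) \<in> ?D" for c
    using E r by (auto simp: chow_graded_part_def homogeneous_polys_def poly_ring_carrier mp_const_def
        mp_var_power mult_single monomial_degree_weighted intro!: imageI)
  have f_mult: "f (chow_class E cd (mp_const c * ?top)) = c * (-1) ^ r" for c
    by (simp add: f[OF mult D] chow_functional_scale chow_functional_top[OF E r])
  have add: "chow_class E cd (mp_const c * ?top) \<oplus>\<^bsub>chow_ring E cd\<^esub> chow_class E cd (mp_const d * ?top) =
      chow_class E cd (mp_const (c + d) * ?top)" for c d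
    by (simp add: chow_class_add mult const_scalar.scalar_add ring_distribs)
  have scale: "chow_scale E cd c (chow_class E cd (mp_const d * ?top)) =
      chow_class E cd (mp_const (c * d) * ?top)" for c d
    by (simp add: chow_scale_def chow_class_mult mult poly_ring_const_closed const_scalar.scalar_mult mult.assoc)
  have gen: "chow_gen E cd \<top>\<^bsub>flat_lattice E cd\<^esub> [^]\<^bsub>chow_ring E cd\<^esub> r = chow_class E cd (mp_const 1 * ?top)"
    using E by (simp add: chow_gen_def top_flats chow_class_power poly_ring_var_closed const_scalar.scalar_one)
  have "is_chow_degree E cd f"
    unfolding is_chow_degree_def Let_def r'
  proof (intro conjI ballI allI)
    show "f \<in> extensional ?D" by (simp add: f_def)
    show "bij_betw f ?D UNIV"
    proof (rule bij_betw_imageI)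
      show "inj_on f ?D"
      proof (rule inj_onI)
        fix x y assume "x \<in> ?D" "y \<in> ?D" and eq: "f x = f y"
        then obtain c d where "x = chow_class E cd (mp_const c * ?top)" "y = chow_class E cd (mp_const d * ?top)"
          using DE by metis
        then show "x = y" using eq by (simp add: f_mult)
      qed
      have "c = f (chow_class E cd (mp_const (c * (-1) ^ r) * ?top))" for c
        by (simp add: f_mult mult.assoc power_mult_distrib[symmetric])
      then show "f ` ?D = UNIV" using D by blast
    qed
    show "f (x \<oplus>\<^bsub>chow_ring E cd\<^esub> y) = f x + f y" if xy: "x \<in> ?D" "y \<in> ?D" for x y
      using DE[OF xy(1)] DE[OF xy(2)] by (auto simp: add f_mult ring_distribs)
    show "f (chow_scale E cd c x) = c * f x" if x: "x \<in> ?D" for c x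
      using DE[OF x] by (auto simp: scale f_mult)
    show "f (chow_gen E cd \<top>\<^bsub>flat_lattice E cd\<^esub> [^]\<^bsub>chow_ring E cd\<^esub> r) = (-1) ^ r"
      unfolding gen f_mult by simp
  qed
  \<comment> \<open>Compatibility with scalars and the normalisation fix \<open>h\<close> on the top
    degree part, extensionality fixes it elsewhere.\<close>
  moreover have "h = f" if h: "is_chow_degree E cd h" for h
  proof
    fix x show "h x = f x"
    proof (cases "x \<in> ?D")
      case True
      then obtain c where c: "x = chow_class E cd (mp_const c * ?top)" using DE by blast
      have "x = chow_scale E cd c (chow_class E cd (mp_const 1 * ?top))" using scale[of c 1] c by simp
      then have "h x = c * h (chow_class E cd (mp_const 1 * ?top))"
        using h D[of 1] unfolding is_chow_degree_def Let_def r' by blast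
      also have "h (chow_class E cd (mp_const 1 * ?top)) = (-1) ^ r"
        using h unfolding is_chow_degree_def Let_def r' gen by blast
      finally show ?thesis using c f_mult by simp
    next
      case False
      then show ?thesis
        using h by (auto simp: is_chow_degree_def Let_def r' f_def extensional_def)
    qed
  qed
  ultimately have "chow_degree E cd = f"
    unfolding chow_degree_def by (rule the_equality)
  then show ?thesis
    using f[of p] p by (auto simp: chow_graded_part_def homogeneous_polys_def)
qed

section \<open>The reduced characteristic polynomial\<close>

text \<open>The right side times \<lambda> - 1 is computed by geometric sums: each flat
  \<open>g\<close> contributes \<open>mu {} g\<close> times \<lambda> to the power
  \<open>cd E - cd g\<close>, minus \<open>mu {} g\<close>. The subtracted constants cancel because
  the Moebius sum over all flats is 0 for nonempty \<open>E\<close>.\<close>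

lemma reduced_char_poly_coeffs:
  assumes E: "E \<in> V" and r: "r + 1 = cd E"
  shows "reduced_char_poly E cd =
    (\<Sum>i\<le>r. Polynomial.monom (\<Sum>g\<in>{g \<in> FL. cd g \<le> r - i}. mu {} g) i)" (is "_ = ?R")
proof -
  let ?x = "[:0, 1:] :: rat poly"
  have monom: "Polynomial.monom c n = Polynomial.smult c (?x ^ n)" for c :: rat and n
    by (simp add: monom_altdef)
  have smult_const: "Polynomial.smult c p = [:c:] * p" for c and p :: "rat poly" by simp
  have x: "[:-1, 1:] = ?x - 1" by (simp add: one_pCons)
  have "?R = (\<Sum>i\<le>r. \<Sum>g\<in>FL. Polynomial.smult (of_bool (cd g \<le> r - i) * mu {} g) (?x ^ i))"
    unfolding monom smult_sum
    by (intro sum.cong refl sum.mono_neutral_cong_left) auto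
  also have "\<dots> = (\<Sum>g\<in>FL. \<Sum>i\<le>r. Polynomial.smult (of_bool (cd g \<le> r - i) * mu {} g) (?x ^ i))"
    by (rule sum.swap)
  also have "\<dots> = (\<Sum>g\<in>FL. Polynomial.smult (mu {} g) (\<Sum>i<cd E - cd g. ?x ^ i))"
  proof (rule sum.cong[OF refl])
    fix g assume "g \<in> FL"
    \<comment> \<open>As \<open>r + 1 = cd E\<close>, the conditions \<open>cd g \<le> r - i\<close>
      and \<open>i < cd E - cd g\<close> agree for \<open>i \<le> r\<close>.\<close>
    have "(\<Sum>i\<le>r. Polynomial.smult (of_bool (cd g \<le> r - i) * mu {} g) (?x ^ i)) =
        (\<Sum>i<cd E - cd g. Polynomial.smult (mu {} g) (?x ^ i))"
      using r by (intro sum.mono_neutral_cong_right) auto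
    then show "(\<Sum>i\<le>r. Polynomial.smult (of_bool (cd g \<le> r - i) * mu {} g) (?x ^ i)) =
        Polynomial.smult (mu {} g) (\<Sum>i<cd E - cd g. ?x ^ i)"
      by (simp only: smult_const sum_distrib_left)
  qed
  finally have "[:-1, 1:] * ?R = (\<Sum>g\<in>FL. Polynomial.smult (mu {} g) ((?x - 1) * (\<Sum>i<cd E - cd g. ?x ^ i)))"
    by (simp only: sum_distrib_left mult_smult_right x)
  also have "\<dots> = (\<Sum>g\<in>FL. Polynomial.monom (mu {} g) (cd E - cd g)) - Polynomial.smult (\<Sum>g\<in>FL. mu {} g) 1"
    by (simp only: power_diff_1_eq[symmetric] smult_diff_right sum_subtractf monom smult_sum)
  also have "(\<Sum>g\<in>FL. mu {} g) = 0"
  proof -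
    have "{z \<in> FL. {} \<subseteq> z \<and> z \<subseteq> E} = FL" using flat_subset by auto
    then show ?thesis
      using mu_sum_right[OF empty_flat ground_flat] E by (auto simp: V_iff)
  qed
  finally have prod: "[:-1, 1:] * ?R = pm_char_poly E cd"
    by (simp add: pm_char_poly_def bottom_flats mu_def)
  have "([:-1, 1:] * ?R) div [:-1, 1:] = ?R"
    by (rule nonzero_mult_div_cancel_left) simp
  then show ?thesis by (simp only: prod reduced_char_poly_def)
qed

lemma reduced_char_poly_eq:
  assumes r: "r + 1 = cd E"
  shows "reduced_char_poly E cd =
    (\<Sum>i\<le>r. Polynomial.monom
       ((-1) ^ (r - i) *
        chow_degree E cd
          (chow_alpha E cd [^]\<^bsub>chow_ring E cd\<^esub> i \<otimes>\<^bsub>chow_ring E cd\<^esub>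
           chow_beta E cd [^]\<^bsub>chow_ring E cd\<^esub> (r - i)))
       i)"
proof -
  have E: "E \<in> V" using r ground_flat cd_empty by (auto simp: V_iff)
  show ?thesis
    unfolding reduced_char_poly_coeffs[OF E r]
  proof (intro sum.cong refl arg_cong2[of _ _ _ _ Polynomial.monom])
    fix i assume i: "i \<in> {..r}"
    let ?p = "- mp_var E :: 'a set rat_mpoly" and ?q = "\<Sum>g\<in>V. mp_var g"
    have g: "graded 1 0 ?p" "graded 1 0 ?q"
      using graded_mono[OF graded_var, of _ 0] E by (auto intro!: graded_uminus graded_sum)
    have "graded (i * 1 + (r - i) * 1) (i * 0 + (r - i) * 0) (?p ^ i * ?q ^ (r - i))"
      by (intro graded_mult graded_power g)
    then have hom: "?p ^ i * ?q ^ (r - i) \<in> homogeneous_polys V r"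
      using i by (simp add: homogeneous_iff_graded)
    have "chow_alpha E cd [^]\<^bsub>chow_ring E cd\<^esub> i \<otimes>\<^bsub>chow_ring E cd\<^esub>
        chow_beta E cd [^]\<^bsub>chow_ring E cd\<^esub> (r - i) = chow_class E cd (?p ^ i * ?q ^ (r - i))"
      using graded_carrier[OF g(1)] graded_carrier[OF g(2)]
      by (simp add: chow_alpha_class[OF E] chow_beta_class chow_class_power chow_class_mult poly_ring_power_closed)
    \<comment> \<open>The sign in the statement cancels the sign produced by
      \<open>chow_functional_alpha_beta\<close>.\<close>
    then show "(\<Sum>g\<in>{g \<in> FL. cd g \<le> r - i}. mu {} g) = (-1) ^ (r - i) *
        chow_degree E cd (chow_alpha E cd [^]\<^bsub>chow_ring E cd\<^esub> i \<otimes>\<^bsub>chow_ring E cd\<^esub>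
          chow_beta E cd [^]\<^bsub>chow_ring E cd\<^esub> (r - i))"
      using i r
      by (simp add: chow_degree_eq[OF r E hom] chow_functional_alpha_beta[OF E] mult.assoc[symmetric]
          power_mult_distrib[symmetric])
  qed
qed

end

theorem theorem6p4:
  fixes E :: "'a set" and cd :: "'a set \<Rightarrow> nat" and r :: nat
  assumes "polymatroid E cd"
    and "loopless E cd"
    and "cd E > 0"
    and "r = cd E - 1"
  shows "reduced_char_poly E cd =
    (\<Sum>i\<le>r. Polynomial.monom
       ((-1) ^ (r - i) *
        chow_degree E cd
          (chow_alpha E cd [^]\<^bsub>chow_ring E cd\<^esub> i \<otimes>\<^bsub>chow_ring E cd\<^esub>
           chow_beta E cd [^]\<^bsub>chow_ring E cd\<^esub> (r - i)))
       i)"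
proof -
  interpret polymatroid E cd by fact
  interpret loopless_polymatroid E cd by unfold_locales fact
  show ?thesis using assms by (intro reduced_char_poly_eq) simp
qed

end
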